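(* Let $n\ge3$. On the manifold of $n\times n$ CMV matrices with fixed determinant, for any labelling $e^{i\theta_1},\ldots,e^{i\theta_n}$ of the eigenvalues, with corresponding spectral masses $\mu_1,\ldots,\mu_n$, $$\big\{\log[\mu_2/\mu_1],\log[\mu_3/\mu_1]\big\}=2\cot\big(\tfrac{\theta_1-\theta_2}{2}\big)+2\cot\big(\tfrac{\theta_2-\theta_3}{2}\big)+2\cot\big(\tfrac{\theta_3-\theta_1}{2}\big)$$ in the Gelfand--Dikij (or, equivalently, Ablowitz--Ladik) bracket.
   Context: CMV matrices: given Verblunsky coefficients $\alpha_0,\ldots,\alpha_{n-2}$ in the open unit disk and $\alpha_{n-1}$ on the unit circle, put $\rho_k=\sqrt{1-|\alpha_k|^2}$, $\Xi_k=\begin{bmatrix}\bar\alpha_k&\rho_k\\ \rho_k&-\alpha_k\end{bmatrix}$ for $0\le k\le n-2$, $\Xi_{-1}=[1]$, $\Xi_{n-1}=[\bar\alpha_{n-1}]$. The CMV matrix is $\mathcal{C}=\mathcal{L}\mathcal{M}$ with $n\times n$ block-diagonal $\mathcal{L}=\mathrm{diag}(\Xi_0,\Xi_2,\ldots)$, $\mathcal{M}=\mathrm{diag}(\Xi_{-1},\Xi_1,\Xi_3,\ldots)$. Since $\det\mathcal{C}=(-1)^{n-1}\bar\alpha_{n-1}$, $(\alpha_0,\dots,\alpha_{n-2})$ are coordinates on the manifold of CMV matrices with fixed determinant. The eigenvalues are distinct and the spectral measure of $(\mathcal{C},e_1)$, $e_1=[1,0,\dots,0]^T$, is $\sum_j\mu_j\delta_{e^{i\theta_j}}$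 with all $\mu_j>0$, i.e. $\langle e_1|h(\mathcal{C})e_1\rangle=\sum_jh(e^{i\theta_j})\mu_j$; $\theta_j,\mu_j$ are smooth functions locally on the manifold. On this manifold the Gelfand--Dikij bracket coincides with the Ablowitz--Ladik bracket, which, with $\alpha_j=u_j+iv_j$, is $$\{f,g\}=\sum_{j=0}^{n-2}\rho_j^2\Big[\frac{\partial f}{\partial u_j}\frac{\partial g}{\partial v_j}-\frac{\partial f}{\partial v_j}\frac{\partial g}{\partial u_j}\Big].$$ *)

theory Defs
  imports
    "HOL-Analysis.Analysis"
    "Jordan_Normal_Form.Char_Poly"
    "Jordan_Normal_Form.Conjugate"
begin

definition rho :: "(nat \<Rightarrow> complex) \<Rightarrow> nat \<Rightarrow> real" where
  "rho \<alpha> k = sqrt (1 - (cmod (\<alpha> k))\<^sup>2)"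

text \<open>The blocks for \<open>0 \<le> k \<le> n - 1\<close>; the remaining block, with index \<open>-1\<close>, is
  \<open>1\<^sub>m 1\<close> and appears explicitly in \<open>cmv_M\<close>.\<close>

definition Xi :: "nat \<Rightarrow> (nat \<Rightarrow> complex) \<Rightarrow> nat \<Rightarrow> complex mat" where
  "Xi n \<alpha> k =
     (if k < n - 1
      then mat_of_rows_list 2
             [[cnj (\<alpha> k), complex_of_real (rho \<alpha> k)],
              [complex_of_real (rho \<alpha> k), - \<alpha> k]]
      else mat_of_rows_list 1 [[cnj (\<alpha> k)]])"

definition cmv_L :: "nat \<Rightarrow> (nat \<Rightarrow> complex) \<Rightarrow> complex mat" where
  "cmv_L n \<alpha> = diag_block_mat (map (Xi n \<alpha>) (filter even [0..<n]))"

definition cmv_M :: "nat \<Rightarrow> (nat \<Rightarrow> complex) \<Rightarrow> complex mat" where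
  "cmv_M n \<alpha> = diag_block_mat (1\<^sub>m 1 # map (Xi n \<alpha>) (filter odd [0..<n]))"

definition cmv :: "nat \<Rightarrow> (nat \<Rightarrow> complex) \<Rightarrow> complex mat" where
  "cmv n \<alpha> = cmv_L n \<alpha> * cmv_M n \<alpha>"

text \<open>Only the entries \<open>\<alpha> 0, \<dots>, \<alpha> (n - 1)\<close> are meaningful; the others are set to zero so
  that a sequence is determined by its Verblunsky coefficients.\<close>

definition verblunsky :: "nat \<Rightarrow> (nat \<Rightarrow> complex) set" where
  "verblunsky n =
     {\<alpha>. (\<forall>k < n - 1. cmod (\<alpha> k) < 1) \<and> cmod (\<alpha> (n - 1)) = 1 \<and> (\<forall>k \<ge> n. \<alpha> k = 0)}"

text \<open>The manifold of CMV matrices with determinant \<open>d\<close>, in the Verblunsky coordinates. The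
  determinant fixes \<open>\<alpha> (n - 1)\<close>, and the topology induced by the product topology of
  \<open>nat \<Rightarrow> complex\<close> is the usual one in the remaining \<open>\<alpha> 0, \<dots>, \<alpha> (n - 2)\<close>.\<close>

definition cmv_manifold :: "nat \<Rightarrow> complex \<Rightarrow> (nat \<Rightarrow> complex) set" where
  "cmv_manifold n d = {\<alpha> \<in> verblunsky n. Determinant.det (cmv n \<alpha>) = d}"

text \<open>\<open>is_mat_fun h A B\<close> says that \<open>B = h(A)\<close> in the sense of the functional calculus. For
  diagonalizable \<open>A\<close>, such as a unitary matrix, exactly one \<open>B\<close> has this property.\<close>

definition is_mat_fun :: "(complex \<Rightarrow> complex) \<Rightarrow> complex mat \<Rightarrow> complex mat \<Rightarrow> bool" where
  "is_mat_fun h A B \<longleftrightarrow>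
     B \<in> carrier_mat (dim_row A) (dim_row A) \<and>
     (\<forall>v z. eigenvector A v z \<longrightarrow> B *\<^sub>v v = h z \<cdot>\<^sub>v v)"

text \<open>The numbers \<open>cis (\<theta> j)\<close>, \<open>1 \<le> j \<le> n\<close>, label the eigenvalues of the CMV matrix without
  repetition, and its spectral measure at \<open>e\<^sub>1\<close> puts mass \<open>\<mu> j\<close> on \<open>cis (\<theta> j)\<close>. Note that
  \<open>w \<bullet>c v\<close> conjugates \<open>v\<close>, and that \<open>e\<^sub>1\<close> is \<open>unit_vec n 0\<close>.\<close>

definition spectral_labelling ::
    "nat \<Rightarrow> (nat \<Rightarrow> complex) \<Rightarrow> (nat \<Rightarrow> real) \<Rightarrow> (nat \<Rightarrow> real) \<Rightarrow> bool" where
  "spectral_labelling n \<alpha> \<theta> \<mu> \<longleftrightarrow>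
     bij_betw (\<lambda>j. cis (\<theta> j)) {1..n} {z. eigenvalue (cmv n \<alpha>) z} \<and>
     (\<forall>j \<in> {1..n}. 0 < \<mu> j) \<and>
     (\<forall>h B. is_mat_fun h (cmv n \<alpha>) B \<longrightarrow>
        (B *\<^sub>v unit_vec n 0) \<bullet>c unit_vec n 0 =
          (\<Sum>j = 1..n. h (cis (\<theta> j)) * complex_of_real (\<mu> j)))"

text \<open>Partial derivatives with respect to \<open>u\<^sub>j\<close> and \<open>v\<^sub>j\<close>, where \<open>\<alpha> j = u\<^sub>j + \<i> v\<^sub>j\<close>.\<close>

definition partial_u :: "nat \<Rightarrow> ((nat \<Rightarrow> complex) \<Rightarrow> real) \<Rightarrow> (nat \<Rightarrow> complex) \<Rightarrow> real" where
  "partial_u j f \<alpha> = deriv (\<lambda>t :: real. f (\<alpha>(j := \<alpha> j + complex_of_real t))) 0"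

definition partial_v :: "nat \<Rightarrow> ((nat \<Rightarrow> complex) \<Rightarrow> real) \<Rightarrow> (nat \<Rightarrow> complex) \<Rightarrow> real" where
  "partial_v j f \<alpha> = deriv (\<lambda>t :: real. f (\<alpha>(j := \<alpha> j + \<i> * complex_of_real t))) 0"

text \<open>The Ablowitz--Ladik bracket; it coincides with the Gelfand--Dikij bracket on the manifold
  of CMV matrices with fixed determinant.\<close>

definition AL_bracket ::
    "nat \<Rightarrow> ((nat \<Rightarrow> complex) \<Rightarrow> real) \<Rightarrow> ((nat \<Rightarrow> complex) \<Rightarrow> real) \<Rightarrow> (nat \<Rightarrow> complex) \<Rightarrow> real" where
  "AL_bracket n f g \<alpha> =
     (\<Sum>j = 0..n - 2. (rho \<alpha> j)\<^sup>2 *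
        (partial_u j f \<alpha> * partial_v j g \<alpha> - partial_v j f \<alpha> * partial_u j g \<alpha>))"

end

theory Submission
  imports Defs
begin

text \<open>Put \<open>s z = (\<Sum>j. \<mu>\<^sub>j / (z - e\<^bsup>i\<theta>\<^sub>j\<^esup>)) = \<langle>e\<^sub>1|(z - C)\<^sup>-\<^sup>1 e\<^sub>1\<rangle>\<close>. Solving \<open>(z - L M) x = e\<^sub>1\<close>
  block by block from the last coordinate upwards gives \<open>s z = 1 / (z - e z)\<close>, where \<open>e\<close> is the
  end of the Schur recursion
  \<open>e\<^sub>k = (cnj \<alpha>\<^sub>k + e\<^sub>k\<^sub>+\<^sub>1 / z) / (1 + \<alpha>\<^sub>k e\<^sub>k\<^sub>+\<^sub>1 / z)\<close>, \<open>e\<^sub>n = 0\<close>. The identity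
  \<open>{e z, e w} = - 2 \<i> (z e w - w e z) (e w - e z) / (z - w)\<close> is preserved by each step of the
  recursion, and it translates into
  \<open>{s z, s w} = - 2 \<i> (w s w - z s z) (s w - s z - (z - w) s z s w) / (z - w)\<close>.
  Comparing residues at \<open>z = e\<^bsup>i\<theta>\<^sub>j\<^esup>\<close> and \<open>w = e\<^bsup>i\<theta>\<^sub>k\<^esup>\<close> yields \<open>{\<mu>\<^sub>j, \<mu>\<^sub>k}\<close>. Everything takes place in
  \<open>1 \<le> cmod z\<close>, where the recursion is nonsingular.\<close>

section \<open>The Schur function and its bracket\<close>

text \<open>On the exterior of the disk, \<open>e z\<close> is the conjugate of the Schur function
  of the spectral measure at the reflected point 1 / cnj z; hence the conjugates and the powers of 1
  / z in the recursion. The constant - 2 i is Wirtinger calculus: with d/du = D + Dbar and d/dv = i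
  (D - Dbar), one gets f_u g_v - f_v g_u = - 2 i (D f Dbar g - Dbar f D g). The obstacle is
  regularity. The angles are given as continuous, nothing is given about how the masses vary, and
  \<open>deriv\<close> is meaningful only where a derivative exists. So differentiability of the
  masses along coordinate lines is extracted from the secular equation (z - e z) s z = 1. The
  eigenvalues move along these lines too, so the derivatives of s carry double poles next to the
  simple ones; {\<mu> j, \<mu> k} is the coefficient of a product of two simple poles. Since the
  recursion is controlled only for 1 \<le> cmod z while the poles sit on the circle itself, residues
  are read off from limits taken from outside the disk.\<close>

text \<open>The Schur algorithm run backwards: \<open>schur_fn \<alpha> z k m\<close> depends on
  \<open>\<alpha> k, \<dots>, \<alpha> (k + m - 1)\<close>. For \<open>admissible \<alpha> k m\<close> and \<open>1 \<le> cmod z\<close> no junk values of the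
  division occur.\<close>

fun schur_fn :: "(nat \<Rightarrow> complex) \<Rightarrow> complex \<Rightarrow> nat \<Rightarrow> nat \<Rightarrow> complex" where
  "schur_fn \<alpha> z k 0 = 0"
| "schur_fn \<alpha> z k (Suc m) =
     (cnj (\<alpha> k) + schur_fn \<alpha> z (Suc k) m / z) / (1 + \<alpha> k * (schur_fn \<alpha> z (Suc k) m / z))"

text \<open>Only the last coefficient of the window may lie on the unit circle: there the tail is 0
  and the denominator is 1. The earlier ones lie strictly inside, which keeps the denominators away
  from 0.\<close>

definition admissible :: "(nat \<Rightarrow> complex) \<Rightarrow> nat \<Rightarrow> nat \<Rightarrow> bool" where
  "admissible \<alpha> k m \<longleftrightarrow>
     (\<forall>i. k \<le> i \<longrightarrow> i < k + m \<longrightarrow> cmod (\<alpha> i) \<le> 1 \<and> (Suc i < k + m \<longrightarrow> cmod (\<alpha> i) < 1))"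

lemma admissible_Suc: "admissible \<alpha> k (Suc m) \<Longrightarrow> admissible \<alpha> (Suc k) m"
  unfolding admissible_def by auto

text \<open>The map is a disk automorphism: the difference of the squared moduli of denominator and
  numerator factors as (1 - |a|^2) (1 - |c|^2).\<close>

lemma norm_moebius_le_1:
  fixes a c :: complex
  assumes "cmod a < 1" "cmod c \<le> 1"
  shows "1 + a * c \<noteq> 0" "cmod ((cnj a + c) / (1 + a * c)) \<le> 1"
proof -
  have lt: "cmod (a * c) < 1"
    using assms mult_left_le[of "cmod c" "cmod a"] by (simp add: norm_mult)
  show nz: "1 + a * c \<noteq> 0"
  proof
    assume "1 + a * c = 0"
    then have "a * c = - 1" by (simp add: add_eq_0_iff)
    then show False using lt by simp
  qed
  have "(cmod (1 + a * c))\<^sup>2 - (cmod (cnj a + c))\<^sup>2 = (1 - (cmod a)\<^sup>2) * (1 - (cmod c)\<^sup>2)"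
    unfolding cmod_power2 by (simp add: power2_eq_square algebra_simps)
  moreover have "0 \<le> (1 - (cmod a)\<^sup>2) * (1 - (cmod c)\<^sup>2)"
    using assms by (intro mult_nonneg_nonneg) (auto simp: abs_square_le_1 power_le_one)
  ultimately have "(cmod (cnj a + c))\<^sup>2 \<le> (cmod (1 + a * c))\<^sup>2" by linarith
  then have "cmod (cnj a + c) \<le> cmod (1 + a * c)" by (rule power2_le_imp_le) simp
  then show "cmod ((cnj a + c) / (1 + a * c)) \<le> 1"
    using nz by (simp add: norm_divide divide_simps)
qed

lemma norm_schur_fn_le_1:
  assumes "admissible \<alpha> k m" "1 \<le> cmod z"
  shows "cmod (schur_fn \<alpha> z k m) \<le> 1"
  using assms
proof (induction m arbitrary: k)
  case (Suc m)
  let ?c = "schur_fn \<alpha> z (Suc k) m / z"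
  show ?case
  proof (cases m)
    case 0
    then show ?thesis using Suc.prems by (simp add: admissible_def)
  next
    case (Suc m')
    have "cmod (schur_fn \<alpha> z (Suc k) m) \<le> 1"
      using Suc.IH Suc.prems admissible_Suc by blast
    then have "cmod ?c \<le> 1"
      using Suc.prems(2) by (simp add: norm_divide divide_simps)
    moreover have "cmod (\<alpha> k) < 1" using Suc.prems(1) Suc by (simp add: admissible_def)
    ultimately show ?thesis using norm_moebius_le_1(2)[of "\<alpha> k" ?c] by simp
  qed
qed simp

lemma schur_fn_denom_nonzero:
  assumes "admissible \<alpha> k (Suc m)" "1 \<le> cmod z"
  shows "1 + \<alpha> k * (schur_fn \<alpha> z (Suc k) m / z) \<noteq> 0"
proof (cases m)
  case (Suc m')
  have "cmod (schur_fn \<alpha> z (Suc k) m) \<le> 1"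
    using norm_schur_fn_le_1 assms admissible_Suc by blast
  then have "cmod (schur_fn \<alpha> z (Suc k) m / z) \<le> 1"
    using assms(2) by (simp add: norm_divide divide_simps)
  moreover have "cmod (\<alpha> k) < 1" using assms(1) Suc by (simp add: admissible_def)
  ultimately show ?thesis using norm_moebius_le_1(1) by blast
qed simp

lemma continuous_on_schur_fn:
  assumes "admissible \<alpha> k m"
  shows "continuous_on {z. 1 \<le> cmod z} (\<lambda>z. schur_fn \<alpha> z k m)"
  using assms
proof (induction m arbitrary: k)
  case (Suc m)
  have IH: "continuous_on {z. 1 \<le> cmod z} (\<lambda>z. schur_fn \<alpha> z (Suc k) m)"
    using Suc admissible_Suc by blast
  have "\<forall>z\<in>{z. 1 \<le> cmod z}. z \<noteq> 0" by auto
  then have c: "continuous_on {z. 1 \<le> cmod z} (\<lambda>z. schur_fn \<alpha> z (Suc k) m / z)"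
    using IH by (intro continuous_intros) auto
  show ?case
    unfolding schur_fn.simps using schur_fn_denom_nonzero[OF Suc.prems]
    by (intro continuous_intros c) auto
qed simp

text \<open>The Wirtinger derivatives of the Schur function with respect to \<open>\<alpha> j\<close> and its conjugate.\<close>

fun schur_d :: "(nat \<Rightarrow> complex) \<Rightarrow> complex \<Rightarrow> nat \<Rightarrow> nat \<Rightarrow> nat \<Rightarrow> complex" where
  "schur_d \<alpha> z j k 0 = 0"
| "schur_d \<alpha> z j k (Suc m) = (let c = schur_fn \<alpha> z (Suc k) m / z in
     (if j = k then - ((cnj (\<alpha> k) + c) * c) / (1 + \<alpha> k * c)\<^sup>2 else 0)
     + (1 - \<alpha> k * cnj (\<alpha> k)) / (1 + \<alpha> k * c)\<^sup>2 * (schur_d \<alpha> z j (Suc k) m / z))"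

fun schur_dbar :: "(nat \<Rightarrow> complex) \<Rightarrow> complex \<Rightarrow> nat \<Rightarrow> nat \<Rightarrow> nat \<Rightarrow> complex" where
  "schur_dbar \<alpha> z j k 0 = 0"
| "schur_dbar \<alpha> z j k (Suc m) = (let c = schur_fn \<alpha> z (Suc k) m / z in
     (if j = k then 1 / (1 + \<alpha> k * c) else 0)
     + (1 - \<alpha> k * cnj (\<alpha> k)) / (1 + \<alpha> k * c)\<^sup>2 * (schur_dbar \<alpha> z j (Suc k) m / z))"

lemma schur_d_eq_0: "j < k \<Longrightarrow> schur_d \<alpha> z j k m = 0"
  by (induction m arbitrary: k) auto

lemma schur_dbar_eq_0: "j < k \<Longrightarrow> schur_dbar \<alpha> z j k m = 0"
  by (induction m arbitrary: k) auto

lemma has_vector_derivative_inverse: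
  fixes f :: "real \<Rightarrow> 'a::real_normed_field"
  assumes "(f has_vector_derivative f') (at x)" "f x \<noteq> 0"
  shows "((\<lambda>t. inverse (f t)) has_vector_derivative - (inverse (f x) * f' * inverse (f x))) (at x)"
  using Deriv.has_derivative_inverse[OF assms(2) assms(1)[unfolded has_vector_derivative_def]]
  by (simp add: has_vector_derivative_def)

text \<open>The quotient rule for one Moebius step; coefficient \<open>j\<close> enters directly at
  step \<open>j\<close> and through the tail at every earlier step. The directions 1 and i will give
  the two partial derivatives.\<close>

lemma has_vector_derivative_schur_fn:
  assumes "admissible \<alpha> k m" "1 \<le> cmod z"
  shows "((\<lambda>t::real. schur_fn (\<alpha>(j := \<alpha> j + of_real t * \<delta>)) z k m) has_vector_derivative
           (schur_d \<alpha> z j k m * \<delta> + schur_dbar \<alpha> z j k m * cnj \<delta>)) (at 0)"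
  using assms
proof (induction m arbitrary: k)
  case (Suc m)
  define A where "A = (\<lambda>t::real. (\<alpha>(j := \<alpha> j + of_real t * \<delta>)))"
  define c where "c = (\<lambda>t. schur_fn (A t) z (Suc k) m / z)"
  \<comment> \<open>The velocity of coefficient \<open>k\<close>; being 0 for
    \<open>j \<noteq> k\<close>, it lets one computation cover both cases.\<close>
  define d where "d = (if j = k then \<delta> else 0)"
  have A0 [simp]: "A 0 = \<alpha>" by (simp add: A_def)
  have Ak: "A t k = \<alpha> k + of_real t * d" for t by (simp add: A_def d_def)
  have dA: "((\<lambda>t. A t k) has_vector_derivative d) (at 0)"
    unfolding Ak by (auto intro!: derivative_eq_intros)
  have dA': "((\<lambda>t. cnj (A t k)) has_vector_derivative cnj d) (at 0)"
    using dA by (rule has_vector_derivative_cnj)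
  have c0: "schur_fn \<alpha> z (Suc k) m / z = c 0" by (simp add: c_def)
  define c' where "c' = schur_d \<alpha> z j (Suc k) m / z * \<delta> + schur_dbar \<alpha> z j (Suc k) m / z * cnj \<delta>"
  have dc: "(c has_vector_derivative c') (at 0)"
    unfolding c_def A_def c'_def
    using has_vector_derivative_divide[OF Suc.IH[OF admissible_Suc[OF Suc.prems(1)] Suc.prems(2)], of z]
    by (simp only: add_divide_distrib times_divide_eq_left)
  have nz: "1 + \<alpha> k * c 0 \<noteq> 0"
    unfolding c_def using schur_fn_denom_nonzero[OF Suc.prems] by simp
  have dn: "((\<lambda>t. cnj (A t k) + c t) has_vector_derivative (cnj d + c')) (at 0)"
    by (rule has_vector_derivative_add[OF dA' dc])
  have dd: "((\<lambda>t. 1 + A t k * c t) has_vector_derivative (\<alpha> k * c' + d * c 0)) (at 0)"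
    using has_vector_derivative_add[OF has_vector_derivative_const has_vector_derivative_mult[OF dA dc]]
    by simp
  have "((\<lambda>t. inverse (1 + A t k * c t)) has_vector_derivative
      - (inverse (1 + \<alpha> k * c 0) * (\<alpha> k * c' + d * c 0) * inverse (1 + \<alpha> k * c 0))) (at 0)"
    using has_vector_derivative_inverse[OF dd] nz by simp
  from has_vector_derivative_mult[OF dn this]
  have "((\<lambda>t. (cnj (A t k) + c t) / (1 + A t k * c t)) has_vector_derivative
     ((cnj d + c') / (1 + \<alpha> k * c 0)
      - (cnj (\<alpha> k) + c 0) * (\<alpha> k * c' + d * c 0) / (1 + \<alpha> k * c 0)\<^sup>2)) (at 0)"
    by (simp add: divide_inverse power2_eq_square mult_ac)
  also have "((cnj d + c') / (1 + \<alpha> k * c 0)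
      - (cnj (\<alpha> k) + c 0) * (\<alpha> k * c' + d * c 0) / (1 + \<alpha> k * c 0)\<^sup>2)
    = - ((cnj (\<alpha> k) + c 0) * c 0) / (1 + \<alpha> k * c 0)\<^sup>2 * d + 1 / (1 + \<alpha> k * c 0) * cnj d
     + (1 - \<alpha> k * cnj (\<alpha> k)) / (1 + \<alpha> k * c 0)\<^sup>2 * c'"
    using nz by (simp add: divide_simps power2_eq_square) (simp add: algebra_simps)
  also have "\<dots> = schur_d \<alpha> z j k (Suc m) * \<delta> + schur_dbar \<alpha> z j k (Suc m) * cnj \<delta>"
    unfolding schur_d.simps schur_dbar.simps Let_def c0 c'_def d_def
    by (cases "j = k") (simp_all only: if_True if_False simp_thms mult_zero_right complex_cnj_zero
        distrib_left distrib_right mult.assoc add_0 add.assoc add.left_commute)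
  finally show ?case unfolding A_def c_def schur_fn.simps .
qed simp

text \<open>Here \<open>a\<close>, \<open>b\<close> stand for \<alpha> k and its conjugate, and
  \<open>c\<close>, \<open>d\<close> for the tails divided by \<open>z\<close> and \<open>w\<close>.
  The first summand is the bracket of the tails transported by the chain rule, the second the
  contribution of coefficient \<open>k\<close> with weight \<rho>^2 = 1 - a b. The sum has the same
  closed form again, as a rational identity in which \<open>b\<close> is a free variable.\<close>

lemma moebius_bracket_step:
  fixes a b c d z w :: complex
  assumes nz: "1 + a * c \<noteq> 0" "1 + a * d \<noteq> 0" "z \<noteq> w"
  shows "(1 - a * b) / (1 + a * c)\<^sup>2 * ((1 - a * b) / (1 + a * d)\<^sup>2) * ((d - c) * (w * d - z * c) / (z - w))
     + (1 - a * b) * (- ((b + c) * c) / (1 + a * c)\<^sup>2 * (1 / (1 + a * d))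
                     - 1 / (1 + a * c) * (- ((b + d) * d) / (1 + a * d)\<^sup>2))
   = (z * ((b + d) / (1 + a * d)) - w * ((b + c) / (1 + a * c)))
      * ((b + d) / (1 + a * d) - (b + c) / (1 + a * c)) / (z - w)"
proof -
  define u where "u = 1 + a * c"
  define v where "v = 1 + a * d"
  have [simp]: "u \<noteq> 0" "v \<noteq> 0" "z \<noteq> w" using nz by (auto simp: u_def v_def)
  have "(1 - a * b) / u\<^sup>2 * ((1 - a * b) / v\<^sup>2) * ((d - c) * (w * d - z * c) / (z - w))
     + (1 - a * b) * (- ((b + c) * c) / u\<^sup>2 * (1 / v) - 1 / u * (- ((b + d) * d) / v\<^sup>2))
    = ((1 - a * b)\<^sup>2 * (d - c) * (w * d - z * c)
       + (1 - a * b) * (- ((b + c) * c) * v + (b + d) * d * u) * (z - w)) / (u\<^sup>2 * v\<^sup>2 * (z - w))"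
    by (simp add: divide_simps power2_eq_square algebra_simps)
  also have "(1 - a * b)\<^sup>2 * (d - c) * (w * d - z * c)
       + (1 - a * b) * (- ((b + c) * c) * v + (b + d) * d * u) * (z - w)
      = (z * (b + d) * u - w * (b + c) * v) * ((b + d) * u - (b + c) * v)"
    unfolding u_def v_def by (simp add: algebra_simps power2_eq_square)
  also have "\<dots> / (u\<^sup>2 * v\<^sup>2 * (z - w))
      = (z * ((b + d) / v) - w * ((b + c) / u)) * ((b + d) / v - (b + c) / u) / (z - w)"
    by (simp add: divide_simps power2_eq_square)
  finally show ?thesis unfolding u_def v_def .
qed

text \<open>The sum is the bracket without its factor - 2 i. Since the tail does not depend on
  \<alpha> k, there are no cross terms: the bracket at \<open>k\<close> is a local term plus the
  tail bracket times the two chain-rule factors, and \<open>moebius_bracket_step\<close> adds them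
  up.\<close>

lemma schur_fn_bracket:
  assumes "admissible \<alpha> k m" "1 \<le> cmod z" "1 \<le> cmod w" "z \<noteq> w"
  shows "(\<Sum>j=k..<k+m. (1 - \<alpha> j * cnj (\<alpha> j)) *
            (schur_d \<alpha> z j k m * schur_dbar \<alpha> w j k m - schur_dbar \<alpha> z j k m * schur_d \<alpha> w j k m))
       = (z * schur_fn \<alpha> w k m - w * schur_fn \<alpha> z k m) * (schur_fn \<alpha> w k m - schur_fn \<alpha> z k m)
          / (z - w)"
  using assms
proof (induction m arbitrary: k)
  case (Suc m)
  have [simp]: "z \<noteq> 0" "w \<noteq> 0" using Suc.prems by auto
  let ?a = "\<alpha> k" let ?b = "cnj (\<alpha> k)"
  define c where "c = schur_fn \<alpha> z (Suc k) m / z"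
  define d where "d = schur_fn \<alpha> w (Suc k) m / w"
  note nz = schur_fn_denom_nonzero[OF Suc.prems(1,2), folded c_def]
    schur_fn_denom_nonzero[OF Suc.prems(1,3), folded d_def]
  define G where "G = (1 - ?a * ?b) / (1 + ?a * c)\<^sup>2 * ((1 - ?a * ?b) / (1 + ?a * d)\<^sup>2)"
  have IH: "(\<Sum>j=Suc k..<Suc k+m. (1 - \<alpha> j * cnj (\<alpha> j)) *
            (schur_d \<alpha> z j (Suc k) m * schur_dbar \<alpha> w j (Suc k) m
             - schur_dbar \<alpha> z j (Suc k) m * schur_d \<alpha> w j (Suc k) m))
    = (z * w * (d - c)) * (w * d - z * c) / (z - w)"
    unfolding Suc.IH[OF admissible_Suc[OF Suc.prems(1)] Suc.prems(2-4)] c_def d_def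
    by (simp add: algebra_simps)
  let ?f = "\<lambda>j. (1 - \<alpha> j * cnj (\<alpha> j)) *
            (schur_d \<alpha> z j k (Suc m) * schur_dbar \<alpha> w j k (Suc m)
             - schur_dbar \<alpha> z j k (Suc m) * schur_d \<alpha> w j k (Suc m))"
  have "sum ?f {k..<k + Suc m} = ?f k + sum ?f {Suc k..<Suc k + m}"
    by (simp add: sum.atLeast_Suc_lessThan)
  also have "sum ?f {Suc k..<Suc k + m} = (\<Sum>j=Suc k..<Suc k+m. G / (z * w) * ((1 - \<alpha> j * cnj (\<alpha> j)) *
            (schur_d \<alpha> z j (Suc k) m * schur_dbar \<alpha> w j (Suc k) m
             - schur_dbar \<alpha> z j (Suc k) m * schur_d \<alpha> w j (Suc k) m)))"
    by (rule sum.cong) (auto simp: G_def Let_def simp flip: c_def d_def,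
        simp add: divide_simps, simp add: algebra_simps)
  also have "\<dots> = G / (z * w) * ((z * w * (d - c)) * (w * d - z * c) / (z - w))"
    by (simp only: IH flip: sum_distrib_left)
  also have "\<dots> = G * ((d - c) * (w * d - z * c) / (z - w))" by simp
  also have "?f k = (1 - ?a * ?b) * (- ((?b + c) * c) / (1 + ?a * c)\<^sup>2 * (1 / (1 + ?a * d))
                     - 1 / (1 + ?a * c) * (- ((?b + d) * d) / (1 + ?a * d)\<^sup>2))"
    by (simp add: schur_d_eq_0 schur_dbar_eq_0 Let_def flip: c_def d_def)
  also have "(1 - ?a * ?b) * (- ((?b + c) * c) / (1 + ?a * c)\<^sup>2 * (1 / (1 + ?a * d))
                     - 1 / (1 + ?a * c) * (- ((?b + d) * d) / (1 + ?a * d)\<^sup>2))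
       + G * ((d - c) * (w * d - z * c) / (z - w))
    = (z * ((?b + d) / (1 + ?a * d)) - w * ((?b + c) / (1 + ?a * c)))
      * ((?b + d) / (1 + ?a * d) - (?b + c) / (1 + ?a * c)) / (z - w)"
    unfolding G_def using moebius_bracket_step[OF nz Suc.prems(4), of ?b] by (simp add: add.commute)
  finally show ?case by (simp flip: c_def d_def)
qed simp

section \<open>Differentiability of poles and weights\<close>

lemma lagrange_interpolation:
  fixes p :: "'a::field poly"
  assumes "finite W" "Polynomial.degree p < card W"
  shows "poly p x = (\<Sum>a\<in>W. poly p a * (\<Prod>b\<in>W - {a}. (x - b) / (a - b)))"
proof -
  define l where "l = (\<lambda>a. \<Prod>b\<in>W - {a}. Polynomial.smult (1 / (a - b)) [:- b, 1:])"
  define q where "q = (\<Sum>a\<in>W. Polynomial.smult (poly p a) (l a))"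
  have l: "poly (l a) y = (\<Prod>b\<in>W - {a}. (y - b) / (a - b))" for a y
    by (simp add: l_def poly_prod diff_divide_distrib)
  have q: "poly q y = (\<Sum>a\<in>W. poly p a * (\<Prod>b\<in>W - {a}. (y - b) / (a - b)))" for y
    by (simp add: q_def poly_sum l)
  have deg_l: "Polynomial.degree (l a) \<le> card W - 1" if "a \<in> W" for a
  proof -
    have "Polynomial.degree (l a) \<le> (\<Sum>b\<in>W - {a}. Polynomial.degree (Polynomial.smult (1 / (a - b)) [:- b, 1:]))"
      unfolding l_def
      using degree_prod_sum_le[of "W - {a}" "\<lambda>b. Polynomial.smult (1 / (a - b)) [:- b, 1:]"] assms(1)
      by (simp add: o_def del: degree_smult_eq)
    also have "\<dots> \<le> (\<Sum>b\<in>W - {a}. 1)"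
      by (rule sum_mono) simp
    also have "\<dots> = card W - 1" using that assms by simp
    finally show ?thesis .
  qed
  have "Polynomial.degree q \<le> card W - 1"
    unfolding q_def
    by (rule degree_sum_le) (use assms deg_l in \<open>auto intro: order.trans[OF degree_smult_le]\<close>)
  then have "Polynomial.degree q < card W" using assms(2) by linarith
  moreover have "poly p c = poly q c" if "c \<in> W" for c
  proof -
    have "poly q c = (\<Sum>a\<in>W. if a = c then poly p a else 0)"
      unfolding q
    proof (rule sum.cong)
      fix a assume a: "a \<in> W"
      show "poly p a * (\<Prod>b\<in>W - {a}. (c - b) / (a - b)) = (if a = c then poly p a else 0)"
      proof (cases "a = c")
        case True
        then have "(\<Prod>b\<in>W - {a}. (c - b) / (a - b)) = (\<Prod>b\<in>W - {a}. 1)"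
          by (intro prod.cong) auto
        then show ?thesis using True by simp
      next
        case False
        then have "(\<Prod>b\<in>W - {a}. (c - b) / (a - b)) = 0"
          using that assms(1) by (intro prod_zero) auto
        then show ?thesis using False by simp
      qed
    qed simp
    then show ?thesis using that assms(1) by simp
  qed
  ultimately have "p = q" using poly_eqI_degree[of W p q] assms(2) by auto
  then show ?thesis using q by metis
qed

lemma differentiable_prod:
  fixes f :: "'i \<Rightarrow> real \<Rightarrow> complex"
  assumes "\<And>i. i \<in> A \<Longrightarrow> f i differentiable (at x)"
  shows "(\<lambda>t. \<Prod>i\<in>A. f i t) differentiable (at x)"
proof (cases "finite A")
  case True
  then show ?thesis using assms
  proof (induction A rule: finite_induct)
    case (insert a A)
    then have "f a differentiable (at x)" "(\<lambda>t. \<Prod>i\<in>A. f i t) differentiable (at x)"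
      by auto
    then show ?case using insert.hyps by simp
  qed simp
qed simp

text \<open>A product rule in which one factor is merely continuous; this suffices because the other
  factor vanishes at 0. It serves \<open>differentiable_root\<close>, where the second factor
  contains masses and poles known only to be continuous.\<close>

lemma has_vector_derivative_mult_at_zero:
  fixes q H :: "real \<Rightarrow> complex"
  assumes q: "(q has_vector_derivative q') (at 0)" "q 0 = 0" and H: "isCont H 0"
  shows "((\<lambda>t. q t * H t) has_vector_derivative q' * H 0) (at 0)"
proof -
  have lim: "(\<lambda>h. norm (q h - h *\<^sub>R q') / norm h) \<midarrow>0\<rightarrow> 0"
    using q unfolding has_vector_derivative_def has_derivative_at by simp
  have H': "H \<midarrow>0\<rightarrow> H 0" using H by (simp add: isCont_def)
  have "(\<lambda>h. norm (q h - h *\<^sub>R q') / norm h * norm (H h) + norm q' * norm (H h - H 0)) \<midarrow>0\<rightarrow>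
      0 * norm (H 0) + norm q' * norm (H 0 - H 0)"
    by (intro tendsto_intros lim H')
  then have lim2: "(\<lambda>h. norm (q h - h *\<^sub>R q') / norm h * norm (H h) + norm q' * norm (H h - H 0)) \<midarrow>0\<rightarrow> 0"
    by simp
  have "norm (q h * H h - h *\<^sub>R (q' * H 0)) / norm h
     \<le> norm (q h - h *\<^sub>R q') / norm h * norm (H h) + norm q' * norm (H h - H 0)" for h
  proof (cases "h = 0")
    case False
    have "norm (q h * H h - h *\<^sub>R (q' * H 0)) = norm ((q h - h *\<^sub>R q') * H h + (h *\<^sub>R q') * (H h - H 0))"
      by (simp add: algebra_simps)
    also have "\<dots> \<le> norm (q h - h *\<^sub>R q') * norm (H h) + norm h * norm q' * norm (H h - H 0)"
      by (rule norm_triangle_le) (simp add: norm_mult)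
    finally show ?thesis using False by (simp add: divide_simps algebra_simps)
  qed (use q in simp)
  then have "(\<lambda>h. norm (q h * H h - h *\<^sub>R (q' * H 0)) / norm h) \<midarrow>0\<rightarrow> 0"
    by (intro Lim_null_comparison[OF _ lim2]) (auto intro!: always_eventually)
  then show ?thesis
    unfolding has_vector_derivative_def has_derivative_at using q(2)
    by (auto intro: bounded_linear_scaleR_left)
qed

text \<open>Poles of modulus one of a family of rational functions that are regular and nonzero outside
  the closed unit disk. A root \<open>z t j\<close> moves differentiably because
  \<open>z 0 j - z t j\<close> is \<open>E (z 0 j) t\<close> times a continuous factor; the weights are recovered by
  Lagrange interpolation from values of \<open>1 / E w\<close> at points \<open>w\<close> outside the disk.\<close>

locale secular_curve =
  fixes J :: "'i set" and \<epsilon> :: real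
    and z \<mu> :: "real \<Rightarrow> 'i \<Rightarrow> complex" and E :: "complex \<Rightarrow> real \<Rightarrow> complex"
  assumes fin: "finite J" and eps: "0 < \<epsilon>"
    and unit: "\<And>t i. \<bar>t\<bar> < \<epsilon> \<Longrightarrow> i \<in> J \<Longrightarrow> cmod (z t i) = 1"
    and inj: "\<And>t. \<bar>t\<bar> < \<epsilon> \<Longrightarrow> inj_on (z t) J"
    and secular: "\<And>t w. \<bar>t\<bar> < \<epsilon> \<Longrightarrow> 1 \<le> cmod w \<Longrightarrow> w \<notin> z t ` J \<Longrightarrow>
          E w t * (\<Sum>i\<in>J. \<mu> t i / (w - z t i)) = 1"
    and root: "\<And>t i. \<bar>t\<bar> < \<epsilon> \<Longrightarrow> i \<in> J \<Longrightarrow> E (z t i) t = 0"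
    and cont: "\<And>i. i \<in> J \<Longrightarrow> isCont (\<lambda>t. z t i) 0"
    and diff_E: "\<And>w. 1 \<le> cmod w \<Longrightarrow> E w differentiable (at 0)"
begin

lemma outside: "\<bar>t\<bar> < \<epsilon> \<Longrightarrow> 1 < cmod w \<Longrightarrow> w \<notin> z t ` J"
  using unit by force

text \<open>The numerator of the partial fraction sum over the common denominator is a polynomial of
  degree below \<open>card J\<close>. At a node \<open>a\<close> the secular equation gives its
  value as the denominator divided by \<open>E a t\<close>; at the pole \<open>z t j\<close> its
  value is \<open>\<mu> t j\<close> times the product of differences. Interpolation thus expresses
  each mass through the poles and finitely many values of \<open>E\<close>.\<close>

lemma interpolation:
  assumes t: "\<bar>t\<bar> < \<epsilon>" and j: "j \<in> J"
    and W: "finite W" "card W = card J" "\<And>a. a \<in> W \<Longrightarrow> 1 < cmod a"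
  shows "\<mu> t j = (\<Sum>a\<in>W. (\<Prod>i\<in>J. a - z t i) / E a t * (\<Prod>b\<in>W - {a}. (z t j - b) / (a - b)))
       / (\<Prod>i\<in>J - {j}. z t j - z t i)"
proof -
  define p where "p = (\<Sum>i\<in>J. Polynomial.smult (\<mu> t i) (\<Prod>l\<in>J - {i}. [:- z t l, 1:]))"
  have p: "poly p x = (\<Sum>i\<in>J. \<mu> t i * (\<Prod>l\<in>J - {i}. x - z t l))" for x
    by (simp add: p_def poly_sum poly_prod)
  have "card J > 0" using fin j by (auto simp: card_gt_0_iff)
  have deg: "Polynomial.degree (\<Prod>l\<in>J - {i}. [:- z t l, 1:]) \<le> card J - 1" if "i \<in> J" for i
  proof -
    have "Polynomial.degree (\<Prod>l\<in>J - {i}. [:- z t l, 1:]) \<le> (\<Sum>l\<in>J - {i}. Polynomial.degree [:- z t l, 1:])"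
      using degree_prod_sum_le[of "J - {i}" "\<lambda>l. [:- z t l, 1:]"] fin by (simp add: o_def)
    then show ?thesis using that fin by simp
  qed
  have "Polynomial.degree p \<le> card J - 1"
    unfolding p_def
    by (rule degree_sum_le) (use fin deg in \<open>auto intro: order.trans[OF degree_smult_le]\<close>)
  then have "Polynomial.degree p < card W" using \<open>card J > 0\<close> W by linarith
  then have lag: "poly p (z t j) = (\<Sum>a\<in>W. poly p a * (\<Prod>b\<in>W - {a}. (z t j - b) / (a - b)))"
    by (rule lagrange_interpolation[OF W(1)])
  have "poly p a = (\<Prod>i\<in>J. a - z t i) / E a t" if "a \<in> W" for a
  proof -
    have a: "a \<notin> z t ` J" using outside[OF t W(3)[OF that]] .
    have s: "E a t * (\<Sum>i\<in>J. \<mu> t i / (a - z t i)) = 1"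
      using secular[OF t _ a] W(3)[OF that] by simp
    have "poly p a = (\<Sum>i\<in>J. (\<Prod>l\<in>J. a - z t l) * (\<mu> t i / (a - z t i)))"
      unfolding p
    proof (rule sum.cong)
      fix i assume i: "i \<in> J"
      then have "a - z t i \<noteq> 0" using a by auto
      then show "\<mu> t i * (\<Prod>l\<in>J - {i}. a - z t l) = (\<Prod>l\<in>J. a - z t l) * (\<mu> t i / (a - z t i))"
        using prod.remove[OF fin i, of "\<lambda>l. a - z t l"] by simp
    qed simp
    also have "\<dots> = (\<Prod>l\<in>J. a - z t l) * (\<Sum>i\<in>J. \<mu> t i / (a - z t i))"
      by (simp add: sum_distrib_left)
    also have "(\<Sum>i\<in>J. \<mu> t i / (a - z t i)) = 1 / E a t"
      using s by (metis mult.commute nonzero_eq_divide_eq zero_neq_one mult_zero_left)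
    finally show ?thesis by simp
  qed
  then have "(\<Sum>a\<in>W. (\<Prod>i\<in>J. a - z t i) / E a t * (\<Prod>b\<in>W - {a}. (z t j - b) / (a - b)))
      = poly p (z t j)"
    unfolding lag by simp
  also have "\<dots> = (\<Sum>i\<in>J. if i = j then \<mu> t j * (\<Prod>l\<in>J - {j}. z t j - z t l) else 0)"
    unfolding p
  proof (rule sum.cong)
    fix i assume i: "i \<in> J"
    show "\<mu> t i * (\<Prod>l\<in>J - {i}. z t j - z t l)
        = (if i = j then \<mu> t j * (\<Prod>l\<in>J - {j}. z t j - z t l) else 0)"
    proof (cases "i = j")
      case False
      then have "(\<Prod>l\<in>J - {i}. z t j - z t l) = 0" using j fin by (intro prod_zero) auto
      then show ?thesis using False by simp
    qed simp
  qed simp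
  also have "\<dots> = \<mu> t j * (\<Prod>l\<in>J - {j}. z t j - z t l)" using j fin by simp
  finally have "(\<Sum>a\<in>W. (\<Prod>i\<in>J. a - z t i) / E a t * (\<Prod>b\<in>W - {a}. (z t j - b) / (a - b)))
     = \<mu> t j * (\<Prod>l\<in>J - {j}. z t j - z t l)" .
  moreover have "(\<Prod>l\<in>J - {j}. z t j - z t l) \<noteq> 0"
    using inj[OF t] j fin by (auto simp: inj_on_def)
  ultimately show ?thesis by simp
qed

text \<open>The nodes are \<open>card J\<close> points independent of \<open>t\<close>; starting at
  2 keeps them outside the closed disk, where \<open>E\<close> has no zeros.\<close>

definition nodes :: "complex set" where
  "nodes = of_nat ` {2..<card J + 2}"

lemma nodes: "finite nodes" "card nodes = card J" "a \<in> nodes \<Longrightarrow> 1 < cmod a"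
  by (auto simp: nodes_def card_image inj_on_def)

lemma E_nonzero: "\<bar>t\<bar> < \<epsilon> \<Longrightarrow> 1 < cmod w \<Longrightarrow> E w t \<noteq> 0"
  using secular[of t w] outside[of t w] by auto

lemma prod_nonzero: "\<bar>t\<bar> < \<epsilon> \<Longrightarrow> j \<in> J \<Longrightarrow> (\<Prod>i\<in>J - {j}. z t j - z t i) \<noteq> 0"
  using inj[of t] fin by (auto simp: inj_on_def)

text \<open>Continuity of the masses is derived, not assumed: the interpolation formula involves
  only the continuous poles and \<open>E\<close> at fixed nodes.\<close>

lemma isCont_weight:
  assumes j: "j \<in> J"
  shows "isCont (\<lambda>t. \<mu> t j) 0"
proof (rule continuous_transform_within[OF _ eps])
  have E: "isCont (\<lambda>t. E a t) 0" if "a \<in> nodes" for a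
    using diff_E[of a] nodes(3)[OF that] differentiable_imp_continuous_within by auto
  have nz: "E a 0 \<noteq> 0" if "a \<in> nodes" for a
    using E_nonzero eps nodes(3)[OF that] by simp
  show "isCont (\<lambda>t. (\<Sum>a\<in>nodes. (\<Prod>i\<in>J. a - z t i) / E a t *
          (\<Prod>b\<in>nodes - {a}. (z t j - b) / (a - b))) / (\<Prod>i\<in>J - {j}. z t j - z t i)) 0"
    using cont E nz prod_nonzero[of 0 j] eps j by (intro continuous_intros) auto
qed (use interpolation[OF _ j nodes] in \<open>auto simp: dist_real_def\<close>)

text \<open>This replaces the implicit function theorem: differentiability of \<open>E\<close> is
  available in \<open>t\<close> for fixed \<open>w\<close>, not in \<open>w\<close>. With
  \<open>w\<close> frozen at the initial pole, multiplying the secular equation by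
  \<open>w - z t j\<close> gives \<open>w - z t j = E w t * H t\<close>, to which the product rule
  with a continuous factor applies.\<close>

lemma differentiable_root:
  assumes j: "j \<in> J"
  shows "(\<lambda>t. z t j) differentiable (at 0)"
proof -
  define w where "w = z 0 j"
  define H where "H = (\<lambda>t. \<mu> t j + (w - z t j) * (\<Sum>i\<in>J - {j}. \<mu> t i / (w - z t i)))"
  have w: "cmod w = 1" using unit[of 0] eps j by (simp add: w_def)
  have ne: "w \<noteq> z 0 i" if "i \<in> J - {j}" for i
    using inj[of 0] eps j that by (auto simp: w_def inj_on_def)
  have H: "isCont H 0"
    unfolding H_def
    by (intro continuous_intros isCont_weight j cont) (use ne isCont_weight cont in auto)
  have "(E w has_vector_derivative vector_derivative (E w) (at 0)) (at 0)"
    using diff_E[of w] w by (simp add: vector_derivative_works)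
  moreover have "E w 0 = 0" using root[of 0 j] eps j by (simp add: w_def)
  ultimately have "((\<lambda>t. E w t * H t) has_vector_derivative vector_derivative (E w) (at 0) * H 0) (at 0)"
    using has_vector_derivative_mult_at_zero H by blast
  then have d: "(\<lambda>t. w - E w t * H t) differentiable (at 0)"
    by (intro differentiable_diff differentiable_const differentiableI_vector)
  \<comment> \<open>The secular equation at \<open>w\<close> requires that no pole sits there; the
    other poles stay away for small \<open>t\<close>, and the case \<open>z t j = w\<close> is
    settled by \<open>root\<close>.\<close>
  have "eventually (\<lambda>t. \<forall>i\<in>J - {j}. z t i \<noteq> w) (at 0)"
    using fin cont ne unfolding isCont_def
    by (intro eventually_ball_finite ballI tendsto_imp_eventually_ne) auto
  then obtain e where e: "e > 0" "\<And>t i. t \<noteq> 0 \<Longrightarrow> \<bar>t\<bar> < e \<Longrightarrow> i \<in> J - {j} \<Longrightarrow> z t i \<noteq> w"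
    unfolding eventually_at dist_real_def by fastforce
  show ?thesis
  proof (rule differentiable_transform_within[OF d])
    show "min e \<epsilon> > 0" using e eps by simp
    fix t :: real assume "dist t 0 < min e \<epsilon>"
    then have t: "\<bar>t\<bar> < e" "\<bar>t\<bar> < \<epsilon>" by (auto simp: dist_real_def)
    show "w - E w t * H t = z t j"
    proof (cases "z t j = w")
      case True
      then show ?thesis using root[OF t(2) j] by simp
    next
      case False
      have "z t i \<noteq> w" if "i \<in> J" for i
        using e(2)[of t i] t that False by (cases "t = 0"; cases "i = j") (auto simp: w_def)
      then have "E w t * (\<Sum>i\<in>J. \<mu> t i / (w - z t i)) = 1"
        using secular[OF t(2), of w] w by force
      moreover have "(w - z t j) * (\<Sum>i\<in>J. \<mu> t i / (w - z t i)) = H t"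
        using False[symmetric] fin j by (simp add: H_def sum.remove[of J j] distrib_left)
      ultimately have "E w t * H t = w - z t j"
        by (metis mult.left_commute mult.right_neutral)
      then show ?thesis by simp
    qed
  qed simp
qed

lemma differentiable_weight:
  assumes j: "j \<in> J"
  shows "(\<lambda>t. \<mu> t j) differentiable (at 0)"
proof (rule differentiable_transform_within[OF _ eps])
  have E: "E a differentiable (at 0)" if "a \<in> nodes" for a
    using diff_E[of a] nodes(3)[OF that] by auto
  have nz: "E a 0 \<noteq> 0" if "a \<in> nodes" for a
    using E_nonzero eps nodes(3)[OF that] by simp
  show "(\<lambda>t. (\<Sum>a\<in>nodes. (\<Prod>i\<in>J. a - z t i) / E a t *
          (\<Prod>b\<in>nodes - {a}. (z t j - b) / (a - b))) / (\<Prod>i\<in>J - {j}. z t j - z t i))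
        differentiable (at 0)"
    by (intro differentiable_divide differentiable_sum differentiable_mult differentiable_prod
        differentiable_diff differentiable_const differentiable_root j ballI E nz nodes(1))
      (use prod_nonzero[of 0 j] eps j in auto)
qed (use interpolation[OF _ j nodes] in \<open>auto simp: dist_real_def\<close>)

text \<open>Differentiate E s = 1 and multiply by s. On the left, the motion of a pole produces the
  double-pole term.\<close>

lemma resolvent_derivative:
  assumes z': "\<And>i. i \<in> J \<Longrightarrow> ((\<lambda>t. z t i) has_vector_derivative z' i) (at 0)"
    and \<mu>': "\<And>i. i \<in> J \<Longrightarrow> ((\<lambda>t. \<mu> t i) has_vector_derivative \<mu>' i) (at 0)"
    and E': "(E w has_vector_derivative E') (at 0)"
    and w: "1 < cmod w"
  shows "(\<Sum>i\<in>J. \<mu>' i / (w - z 0 i) + \<mu> 0 i * z' i / (w - z 0 i)\<^sup>2)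
       = - E' * (\<Sum>i\<in>J. \<mu> 0 i / (w - z 0 i))\<^sup>2"
proof -
  define s where "s = (\<lambda>t. \<Sum>i\<in>J. \<mu> t i / (w - z t i))"
  define s' where "s' = (\<Sum>i\<in>J. \<mu>' i / (w - z 0 i) + \<mu> 0 i * z' i / (w - z 0 i)\<^sup>2)"
  have ds: "(s has_vector_derivative s') (at 0)"
    unfolding s_def s'_def
  proof (rule has_vector_derivative_sum)
    fix i assume i: "i \<in> J"
    have nz: "w - z 0 i \<noteq> 0" using outside[of 0 w] eps w i by auto
    have "((\<lambda>t. w - z t i) has_vector_derivative 0 - z' i) (at 0)"
      by (intro has_vector_derivative_diff has_vector_derivative_const z' i)
    from has_vector_derivative_inverse[OF this] nz
    have "((\<lambda>t. inverse (w - z t i)) has_vector_derivative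
        inverse (w - z 0 i) * z' i * inverse (w - z 0 i)) (at 0)"
      by simp
    from has_vector_derivative_mult[OF \<mu>'[OF i] this]
    show "((\<lambda>t. \<mu> t i / (w - z t i)) has_vector_derivative
        \<mu>' i / (w - z 0 i) + \<mu> 0 i * z' i / (w - z 0 i)\<^sup>2) (at 0)"
      by (simp add: divide_inverse power2_eq_square mult_ac add.commute)
  qed
  have sE: "E w t * s t = 1" if "\<bar>t\<bar> < \<epsilon>" for t
    using secular[OF that _ outside[OF that w]] w by (simp add: s_def)
  have "((\<lambda>t. E w t * s t) has_vector_derivative (E w 0 * s' + E' * s 0)) (at 0)"
    by (rule has_vector_derivative_mult[OF E' ds])
  moreover have "((\<lambda>t. E w t * s t) has_vector_derivative 0) (at 0)"
    by (rule has_vector_derivative_transform_within[OF has_vector_derivative_const eps])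
      (use sE in \<open>auto simp: dist_real_def\<close>)
  ultimately have "E w 0 * s' + E' * s 0 = 0"
    by (rule vector_derivative_unique_at)
  then have "E w 0 * s' = - E' * s 0" by (simp add: eq_neg_iff_add_eq_0)
  then have "(E w 0 * s 0) * s' = - E' * (s 0)\<^sup>2"
    by (metis mult.assoc mult.left_commute power2_eq_square)
  then show ?thesis using sE[of 0] eps by (simp add: s_def s'_def)
qed

end

section \<open>Principal parts on the unit circle\<close>

text \<open>The coefficients of the principal part of order at most two at a point \<open>p\<close> of the unit
  circle, for functions of which only the restriction to the outside of the disk matters.\<close>

definition principal_part :: "(complex \<Rightarrow> complex) \<Rightarrow> complex \<Rightarrow> complex \<Rightarrow> complex \<Rightarrow> bool" where
  "principal_part f p Y X \<longleftrightarrow>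
     (\<exists>L. ((\<lambda>z. f z - Y / (z - p)\<^sup>2 - X / (z - p)) \<longlongrightarrow> L) (at p within {z. 1 < cmod z}))"

text \<open>The points p (1 + 1/n) approach \<open>p\<close> radially; nontriviality makes limits
  from outside unique.\<close>

lemma at_within_outside_disk_nontrivial:
  assumes "cmod p = 1"
  shows "at p within {z. 1 < cmod z} \<noteq> bot"
proof -
  have "p \<in> closure {z. 1 < cmod z}"
    unfolding closure_sequential
  proof (intro exI conjI allI)
    fix n :: nat
    have "1 < cmod (p * of_real (1 + 1 / Suc n))" 
      unfolding norm_mult norm_of_real assms by (simp add: divide_simps)
    then show "p * of_real (1 + 1 / Suc n) \<in> {z. 1 < cmod z}" by simp
    have "(\<lambda>n. p * of_real (1 + 1 / Suc n)) \<longlonglongrightarrow> p * of_real (1 + 0)"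
      by (intro tendsto_intros LIMSEQ_Suc[OF lim_1_over_n])
    then show "(\<lambda>n. p * of_real (1 + 1 / Suc n)) \<longlonglongrightarrow> p" by simp
  qed
  moreover have "p \<notin> {z. 1 < cmod z}" using assms by simp
  ultimately show ?thesis
    by (simp add: closure_def trivial_limit_within)
qed

text \<open>The difference of the two principal parts has a finite limit. Multiplying it by (z -
  p)^2 forces the double-pole coefficients to agree, and then multiplying by z - p forces the
  residues to agree.\<close>

lemma principal_part_unique:
  assumes f: "principal_part f p Y X" and g: "principal_part g p Y' X'" and p: "cmod p = 1"
    and eq: "eventually (\<lambda>z. f z = g z) (at p within {z. 1 < cmod z})"
  shows "Y = Y'" "X = X'"
proof -
  let ?F = "at p within {z. 1 < cmod z}"
  note nt = at_within_outside_disk_nontrivial[OF p]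
  have id: "((\<lambda>z. z - p) \<longlongrightarrow> 0) ?F"
    by (rule tendsto_eq_intros | simp)+
  have ne: "eventually (\<lambda>z. z \<noteq> p) ?F"
    by (simp add: eventually_at_filter)
  obtain L where "((\<lambda>z. f z - Y / (z - p)\<^sup>2 - X / (z - p)) \<longlongrightarrow> L) ?F"
    using f unfolding principal_part_def by auto
  moreover obtain L' where "((\<lambda>z. g z - Y' / (z - p)\<^sup>2 - X' / (z - p)) \<longlongrightarrow> L') ?F"
    using g unfolding principal_part_def by auto
  ultimately have "((\<lambda>z. (g z - Y' / (z - p)\<^sup>2 - X' / (z - p)) - (f z - Y / (z - p)\<^sup>2 - X / (z - p)))
      \<longlongrightarrow> L' - L) ?F"
    by (intro tendsto_diff)
  moreover have "eventually (\<lambda>z. (g z - Y' / (z - p)\<^sup>2 - X' / (z - p)) - (f z - Y / (z - p)\<^sup>2 - X / (z - p))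
      = (Y - Y') / (z - p)\<^sup>2 + (X - X') / (z - p)) ?F"
    using eq by eventually_elim (simp add: diff_divide_distrib)
  ultimately have lim: "((\<lambda>z. (Y - Y') / (z - p)\<^sup>2 + (X - X') / (z - p)) \<longlongrightarrow> L' - L) ?F"
    by (rule Lim_transform_eventually)
  have "((\<lambda>z. ((Y - Y') / (z - p)\<^sup>2 + (X - X') / (z - p)) * (z - p)\<^sup>2 - (X - X') * (z - p))
      \<longlongrightarrow> (L' - L) * 0\<^sup>2 - (X - X') * 0) ?F"
    by (intro tendsto_intros lim id)
  moreover have "eventually (\<lambda>z. ((Y - Y') / (z - p)\<^sup>2 + (X - X') / (z - p)) * (z - p)\<^sup>2
      - (X - X') * (z - p) = Y - Y') ?F"
    using ne by eventually_elim (simp add: divide_simps power2_eq_square)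
  ultimately have "((\<lambda>z. Y - Y') \<longlongrightarrow> 0) ?F"
    by (auto dest: Lim_transform_eventually)
  then show Y: "Y = Y'" using nt by (simp add: tendsto_const_iff)
  have "((\<lambda>z. ((Y - Y') / (z - p)\<^sup>2 + (X - X') / (z - p)) * (z - p)) \<longlongrightarrow> (L' - L) * 0) ?F"
    by (intro tendsto_intros lim id)
  moreover have "eventually (\<lambda>z. ((Y - Y') / (z - p)\<^sup>2 + (X - X') / (z - p)) * (z - p) = X - X') ?F"
    using ne by eventually_elim (simp add: Y)
  ultimately have "((\<lambda>z. X - X') \<longlongrightarrow> 0) ?F"
    by (auto dest: Lim_transform_eventually)
  then show "X = X'" using nt by (simp add: tendsto_const_iff)
qed

lemma principal_part_add:
  assumes "principal_part f p Y X" "principal_part g p Y' X'"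
  shows "principal_part (\<lambda>z. f z + g z) p (Y + Y') (X + X')"
proof -
  obtain L L' where "((\<lambda>z. f z - Y / (z - p)\<^sup>2 - X / (z - p)) \<longlongrightarrow> L) (at p within {z. 1 < cmod z})"
    "((\<lambda>z. g z - Y' / (z - p)\<^sup>2 - X' / (z - p)) \<longlongrightarrow> L') (at p within {z. 1 < cmod z})"
    using assms unfolding principal_part_def by auto
  from tendsto_add[OF this] show ?thesis
    unfolding principal_part_def by (intro exI[of _ "L + L'"]) (simp add: add_divide_distrib algebra_simps)
qed

lemma principal_part_cmult:
  assumes "principal_part f p Y X"
  shows "principal_part (\<lambda>z. c * f z) p (c * Y) (c * X)"
proof -
  obtain L where "((\<lambda>z. f z - Y / (z - p)\<^sup>2 - X / (z - p)) \<longlongrightarrow> L) (at p within {z. 1 < cmod z})"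
    using assms unfolding principal_part_def by auto
  from tendsto_mult_left[OF this, of c] show ?thesis
    unfolding principal_part_def by (intro exI[of _ "c * L"]) (simp add: algebra_simps)
qed

lemma principal_part_diff:
  assumes "principal_part f p Y X" "principal_part g p Y' X'"
  shows "principal_part (\<lambda>z. f z - g z) p (Y - Y') (X - X')"
  using principal_part_add[OF assms(1) principal_part_cmult[OF assms(2), of "- 1"]] by simp

text \<open>Replacing the regular parts by their values at \<open>p\<close> in the residue leaves
  difference quotients, which converge by differentiability at \<open>p\<close>.\<close>

lemma principal_part_mult:
  assumes "a field_differentiable (at p)" "b field_differentiable (at p)"
  shows "principal_part (\<lambda>z. (\<mu> / (z - p) + a z) * (\<nu> / (z - p) + b z)) p
           (\<mu> * \<nu>) (\<mu> * b p + \<nu> * a p)"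
proof -
  let ?F = "at p within {z. 1 < cmod z}"
  obtain a' b' where d: "(a has_field_derivative a') (at p)" "(b has_field_derivative b') (at p)"
    using assms unfolding field_differentiable_def by auto
  then have c: "isCont a p" "isCont b p" by (auto intro: DERIV_isCont)
  have "((\<lambda>z. a z * b z + \<mu> * ((b z - b p) / (z - p)) + \<nu> * ((a z - a p) / (z - p)))
     \<longlongrightarrow> a p * b p + \<mu> * b' + \<nu> * a') (at p)"
    using d c unfolding has_field_derivative_iff isCont_def
    by (intro tendsto_add tendsto_mult[OF tendsto_const] tendsto_mult[of a] conjI)
  then have lim: "((\<lambda>z. a z * b z + \<mu> * ((b z - b p) / (z - p)) + \<nu> * ((a z - a p) / (z - p)))
     \<longlongrightarrow> a p * b p + \<mu> * b' + \<nu> * a') ?F"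
    by (rule tendsto_within_subset) simp
  have "eventually (\<lambda>z. z \<noteq> p) ?F" by (simp add: eventually_at_filter)
  then have "eventually (\<lambda>z. a z * b z + \<mu> * ((b z - b p) / (z - p)) + \<nu> * ((a z - a p) / (z - p))
     = (\<mu> / (z - p) + a z) * (\<nu> / (z - p) + b z) - \<mu> * \<nu> / (z - p)\<^sup>2
       - (\<mu> * b p + \<nu> * a p) / (z - p)) ?F"
    by eventually_elim (simp add: divide_simps power2_eq_square, simp add: algebra_simps)
  from Lim_transform_eventually[OF lim this] show ?thesis
    unfolding principal_part_def by blast
qed

lemma principal_part_sum_poles:
  assumes "finite J" "j \<in> J" "inj_on p J"
  shows "principal_part (\<lambda>z. \<Sum>i\<in>J. X i / (z - p i) + Y i / (z - p i)\<^sup>2) (p j) (Y j) (X j)"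
proof -
  define h where "h = (\<lambda>z. \<Sum>i\<in>J - {j}. X i / (z - p i) + Y i / (z - p i)\<^sup>2)"
  have ne: "p j - p i \<noteq> 0" if "i \<in> J - {j}" for i
    using assms that by (auto simp: inj_on_def)
  have "isCont h (p j)"
    unfolding h_def using ne by (intro continuous_intros) auto
  then have h: "(h \<longlongrightarrow> h (p j)) (at (p j) within {z. 1 < cmod z})"
    unfolding isCont_def by (rule tendsto_within_subset) simp
  have "(\<lambda>z. (\<Sum>i\<in>J. X i / (z - p i) + Y i / (z - p i)\<^sup>2) - Y j / (z - p j)\<^sup>2 - X j / (z - p j)) = h"
    unfolding h_def using assms by (auto simp: sum.remove)
  then show ?thesis using h unfolding principal_part_def by auto
qed

lemma field_differentiable_sum_poles:
  assumes "\<And>i. i \<in> A \<Longrightarrow> q \<noteq> p i"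
  shows "(\<lambda>z::complex. \<Sum>i\<in>A. X i / (z - p i)) field_differentiable (at q)"
  using assms by (auto intro!: field_differentiable_sum field_differentiable_divide
      field_differentiable_diff field_differentiable_const field_differentiable_ident)

text \<open>Divided differences of \<open>s z = (\<Sum>i\<in>J. \<mu> i / (z - p i))\<close> turn the right-hand side into a
  product of two sums of simple poles, in each of the two variables.\<close>

lemma resolvent_bracket_factorization:
  fixes p \<mu> :: "'i \<Rightarrow> complex"
  assumes z: "z \<notin> p ` J" and w: "w \<notin> p ` J" and zw: "z \<noteq> w"
  defines "s \<equiv> \<lambda>z. \<Sum>i\<in>J. \<mu> i / (z - p i)"
  shows "(w * s w - z * s z) * (s w - s z - (z - w) * s z * s w) / (z - w)
    = (\<Sum>l\<in>J. \<mu> l * (1 / (w - p l) - s w) / (z - p l))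
      * ((\<Sum>l\<in>J. \<mu> l * p l / (w - p l)) - (\<Sum>l\<in>J. \<mu> l * p l / (z - p l)))"
proof -
  have nz: "z - p i \<noteq> 0" "w - p i \<noteq> 0" if "i \<in> J" for i using z w that by auto
  \<comment> \<open>The total mass is independent of \<open>x\<close>, so it cancels in
    \<open>w * s w - z * s z\<close>.\<close>
  have t: "x * s x = (\<Sum>i\<in>J. \<mu> i) + (\<Sum>l\<in>J. \<mu> l * p l / (x - p l))"
    if "x \<notin> p ` J" for x
    unfolding s_def sum_distrib_left sum.distrib[symmetric]
  proof (rule sum.cong)
    fix i assume "i \<in> J"
    then have "x - p i \<noteq> 0" using that by auto
    then show "x * (\<mu> i / (x - p i)) = \<mu> i + \<mu> i * p i / (x - p i)"
      by (simp add: divide_simps) (simp add: algebra_simps)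
  qed simp
  have "s w - s z = (\<Sum>l\<in>J. (z - w) * (\<mu> l / (w - p l) / (z - p l)))"
    unfolding s_def sum_subtractf[symmetric]
  proof (rule sum.cong)
    fix i assume "i \<in> J"
    then show "\<mu> i / (w - p i) - \<mu> i / (z - p i) = (z - w) * (\<mu> i / (w - p i) / (z - p i))"
      using nz[of i] by (simp add: divide_simps) (simp add: algebra_simps)
  qed simp
  define D where "D = (\<Sum>l\<in>J. \<mu> l / (w - p l) / (z - p l))"
  have "s w - s z = (z - w) * D"
    unfolding D_def sum_distrib_left by fact
  moreover have "(\<Sum>l\<in>J. \<mu> l * (1 / (w - p l) - s w) / (z - p l))
     = D - s z * s w"
  proof -
    have sz: "s z * s w = (\<Sum>l\<in>J. \<mu> l / (z - p l) * s w)"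
      unfolding sum_distrib_right[symmetric] by (simp add: s_def)
    show ?thesis
      unfolding sz D_def sum_subtractf[symmetric]
      by (rule sum.cong) (simp_all add: right_diff_distrib diff_divide_distrib)
  qed
  ultimately have "s w - s z - (z - w) * s z * s w
     = (z - w) * (\<Sum>l\<in>J. \<mu> l * (1 / (w - p l) - s w) / (z - p l))"
    by (simp only: right_diff_distrib mult.assoc)
  then show ?thesis using zw t[OF z] t[OF w] by simp
qed

text \<open>Residues are taken one variable at a time: at \<open>p j\<close> in \<open>z\<close>
  with \<open>w\<close> fixed outside the disk, then at \<open>p k\<close> in \<open>w\<close>. The
  matrices \<open>MM\<close>, \<open>MZ\<close>, \<open>ZM\<close>, \<open>ZZ\<close> collect the
  pairings of simple and double poles, and \<open>MM j k\<close> belongs to the pair of simple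
  poles.\<close>

lemma residue_of_resolvent_bracket:
  fixes p \<mu> :: "'i \<Rightarrow> complex" and MM MZ ZM ZZ :: "'i \<Rightarrow> 'i \<Rightarrow> complex" and c :: complex
  assumes fin: "finite J" and inj: "inj_on p J" and unit: "\<And>i. i \<in> J \<Longrightarrow> cmod (p i) = 1"
  defines "s \<equiv> \<lambda>z. \<Sum>i\<in>J. \<mu> i / (z - p i)"
  assumes bracket: "\<And>z w. 1 < cmod z \<Longrightarrow> 1 < cmod w \<Longrightarrow> z \<noteq> w \<Longrightarrow>
     (\<Sum>i\<in>J. (\<Sum>l\<in>J. MM i l / (w - p l) + MZ i l / (w - p l)\<^sup>2) / (z - p i)
          + (\<Sum>l\<in>J. ZM i l / (w - p l) + ZZ i l / (w - p l)\<^sup>2) / (z - p i)\<^sup>2)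
       = c * ((w * s w - z * s z) * (s w - s z - (z - w) * s z * s w) / (z - w))"
    and j: "j \<in> J" and k: "k \<in> J" and jk: "j \<noteq> k"
  defines "A \<equiv> \<lambda>i. \<Sum>l\<in>J - {i}. \<mu> l * (p i + p l) / (p i - p l)"
  shows "MM j k = c * (\<mu> j * \<mu> k * ((p k + p j) / (p k - p j) - A k + A j))"
proof -
  let ?out = "{z. 1 < cmod z}"
  have out: "z \<notin> p ` J" if "1 < cmod z" for z using unit that by force
  have ne: "p i \<noteq> p l" if "i \<in> J" "l \<in> J - {i}" for i l
    using inj that by (auto simp: inj_on_def)
  define B where "B = (\<Sum>l\<in>J - {j}. \<mu> l * p l / (p j - p l))"
  define S where "S = (\<Sum>l\<in>J - {j}. \<mu> l / (p j - p l))"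
  \<comment> \<open>As functions of \<open>z\<close>, the two factors of the right-hand side are the
    sum of \<kappa> w l / (z - p l) and W w minus a sum of simple poles.\<close>
  define \<kappa> where "\<kappa> = (\<lambda>w l. \<mu> l * (1 / (w - p l) - s w))"
  define W where "W = (\<lambda>w. \<Sum>l\<in>J. \<mu> l * p l / (w - p l))"
  have residue_z: "(\<Sum>l\<in>J. MM j l / (w - p l) + MZ j l / (w - p l)\<^sup>2)
      = c * (\<kappa> w j * (W w - B) - \<mu> j * p j * (\<Sum>l\<in>J - {j}. \<kappa> w l / (p j - p l)))"
    if w: "1 < cmod w" for w
  proof (rule principal_part_unique(2)[OF principal_part_sum_poles[OF fin j inj]])
    let ?a = "\<lambda>z. \<Sum>l\<in>J - {j}. \<kappa> w l / (z - p l)"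
    let ?b = "\<lambda>z. W w - (\<Sum>l\<in>J - {j}. \<mu> l * p l / (z - p l))"
    have "principal_part (\<lambda>z. (\<kappa> w j / (z - p j) + ?a z) * ((- (\<mu> j * p j)) / (z - p j) + ?b z)) (p j)
       (\<kappa> w j * (- (\<mu> j * p j))) (\<kappa> w j * ?b (p j) + (- (\<mu> j * p j)) * ?a (p j))"
      using ne[OF j]
      by (intro principal_part_mult field_differentiable_sum_poles
          field_differentiable_diff field_differentiable_const) auto
    from principal_part_cmult[OF this, of c]
    show "principal_part (\<lambda>z. c * ((\<kappa> w j / (z - p j) + ?a z) * ((- (\<mu> j * p j)) / (z - p j) + ?b z))) (p j)
       (c * (\<kappa> w j * (- (\<mu> j * p j))))
       (c * (\<kappa> w j * (W w - B) - \<mu> j * p j * (\<Sum>l\<in>J - {j}. \<kappa> w l / (p j - p l))))"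
      by (simp add: B_def)
    show "cmod (p j) = 1" using unit j .
    have "eventually (\<lambda>z. z \<in> ?out) (at (p j) within ?out)"
      by (simp add: eventually_at_filter)
    moreover have "eventually (\<lambda>z. z \<noteq> w) (at (p j) within ?out)"
      using w unit[OF j] by (intro tendsto_imp_eventually_ne[OF tendsto_ident_at]) auto
    ultimately show "eventually (\<lambda>z.
        (\<Sum>i\<in>J. (\<Sum>l\<in>J. MM i l / (w - p l) + MZ i l / (w - p l)\<^sup>2) / (z - p i)
          + (\<Sum>l\<in>J. ZM i l / (w - p l) + ZZ i l / (w - p l)\<^sup>2) / (z - p i)\<^sup>2)
        = c * ((\<kappa> w j / (z - p j) + ?a z) * ((- (\<mu> j * p j)) / (z - p j) + ?b z)))
       (at (p j) within ?out)"
    proof eventually_elim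
      case (elim z)
      have "(w * s w - z * s z) * (s w - s z - (z - w) * s z * s w) / (z - w)
         = (\<Sum>l\<in>J. \<kappa> w l / (z - p l)) * (W w - (\<Sum>l\<in>J. \<mu> l * p l / (z - p l)))"
        unfolding s_def \<kappa>_def W_def
        using elim w out by (intro resolvent_bracket_factorization) auto
      also have "(\<Sum>l\<in>J. \<kappa> w l / (z - p l)) = \<kappa> w j / (z - p j) + ?a z"
        by (rule sum.remove[OF fin j])
      also have "(\<Sum>l\<in>J. \<mu> l * p l / (z - p l))
          = \<mu> j * p j / (z - p j) + (\<Sum>l\<in>J - {j}. \<mu> l * p l / (z - p l))"
        by (rule sum.remove[OF fin j])
      also have "W w - (\<mu> j * p j / (z - p j) + (\<Sum>l\<in>J - {j}. \<mu> l * p l / (z - p l)))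
          = (- (\<mu> j * p j)) / (z - p j) + ?b z"
        by simp
      finally show ?case using bracket[of z w] elim w by simp
    qed
  qed
  let ?F = "at (p k) within ?out"
  have "principal_part (\<lambda>w. \<Sum>l\<in>J. MM j l / (w - p l) + MZ j l / (w - p l)\<^sup>2) (p k) (MZ j k) (MM j k)"
    by (rule principal_part_sum_poles[OF fin k inj])
  moreover
  let ?a = "\<lambda>w. \<mu> j / (w - p j) - \<mu> j * (\<Sum>l\<in>J - {k}. \<mu> l / (w - p l))"
  let ?b = "\<lambda>w. (\<Sum>l\<in>J - {k}. \<mu> l * p l / (w - p l)) - B"
  \<comment> \<open>Residues in \<open>w\<close> of the sum of \<kappa> w l / (p j - p l) over
    \<open>l \<noteq> j\<close>: the first part comes from 1 / (w - p l), the second from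
    \<open>s w\<close>, which occurs with total coefficient \<open>S\<close>.\<close>
  define X where "X = (\<lambda>l. (if l = j then 0 else \<mu> l / (p j - p l)) - \<mu> l * S)"
  let ?f = "\<lambda>w. ((- (\<mu> j * \<mu> k)) / (w - p k) + ?a w) * ((\<mu> k * p k) / (w - p k) + ?b w)"
  let ?g = "\<lambda>w. \<Sum>l\<in>J. X l / (w - p l) + 0 / (w - p l)\<^sup>2"
  let ?R = "(- (\<mu> j * \<mu> k)) * ?b (p k) + (\<mu> k * p k) * ?a (p k)"
  have f: "principal_part ?f (p k) ((- (\<mu> j * \<mu> k)) * (\<mu> k * p k)) ?R"
    using ne[OF k] ne[OF k, of j] j jk
    by (intro principal_part_mult field_differentiable_sum_poles field_differentiable_mult
        field_differentiable_divide field_differentiable_ident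
        field_differentiable_diff field_differentiable_const) auto
  have g: "principal_part ?g (p k) 0 (X k)"
    by (rule principal_part_sum_poles[OF fin k inj])
  have "principal_part (\<lambda>w. c * (?f w - (\<mu> j * p j) * ?g w)) (p k)
    (c * ((- (\<mu> j * \<mu> k)) * (\<mu> k * p k) - (\<mu> j * p j) * 0)) (c * (?R - (\<mu> j * p j) * X k))"
    by (intro principal_part_cmult principal_part_diff f g)
  moreover have "cmod (p k) = 1" using unit k .
  moreover have "eventually (\<lambda>w. w \<in> ?out) ?F" by (simp add: eventually_at_filter)
  then have "eventually (\<lambda>w. (\<Sum>l\<in>J. MM j l / (w - p l) + MZ j l / (w - p l)\<^sup>2)
      = c * (?f w - (\<mu> j * p j) * ?g w)) ?F"
  proof eventually_elim
    case (elim w)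
    have sw: "s w = \<mu> k / (w - p k) + (\<Sum>l\<in>J - {k}. \<mu> l / (w - p l))"
      unfolding s_def by (rule sum.remove[OF fin k])
    have \<kappa>j: "\<kappa> w j = (- (\<mu> j * \<mu> k)) / (w - p k) + ?a w"
      unfolding \<kappa>_def sw by (simp add: algebra_simps)
    have Ww: "W w = \<mu> k * p k / (w - p k) + (\<Sum>l\<in>J - {k}. \<mu> l * p l / (w - p l))"
      unfolding W_def by (rule sum.remove[OF fin k])
    have "?g w = (\<Sum>l\<in>J. (if l = j then 0 else \<mu> l / (p j - p l) / (w - p l))) - S * s w"
      unfolding X_def s_def sum_distrib_left sum_subtractf[symmetric]
      by (rule sum.cong) (auto simp: diff_divide_distrib)
    also have "(\<Sum>l\<in>J. (if l = j then 0 else \<mu> l / (p j - p l) / (w - p l)))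
       = (\<Sum>l\<in>J - {j}. \<mu> l / (p j - p l) / (w - p l))"
      unfolding sum.remove[OF fin j] by simp
    also have "\<dots> - S * s w = (\<Sum>l\<in>J - {j}. \<kappa> w l / (p j - p l))"
      unfolding S_def sum_distrib_right sum_subtractf[symmetric] \<kappa>_def
      by (rule sum.cong) (auto simp: diff_divide_distrib right_diff_distrib mult.commute)
    finally show ?case
      using residue_z[of w] elim by (simp add: \<kappa>j Ww)
  qed
  ultimately have "MM j k = c * (?R - (\<mu> j * p j) * X k)"
    by (rule principal_part_unique(2))
  moreover have "?R - (\<mu> j * p j) * X k
     = \<mu> j * \<mu> k * ((p k + p j) / (p k - p j) - A k + A j)"
  proof -
    have Aj: "A j = B + p j * S"
      unfolding A_def B_def S_def sum_distrib_left sum.distrib[symmetric]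
      by (rule sum.cong) (auto simp: distrib_left add_divide_distrib)
    have Ak: "A k = (\<Sum>l\<in>J - {k}. \<mu> l * p l / (p k - p l)) + p k * (\<Sum>l\<in>J - {k}. \<mu> l / (p k - p l))"
      unfolding A_def sum_distrib_left sum.distrib[symmetric]
      by (rule sum.cong) (auto simp: distrib_left add_divide_distrib)
    have d: "\<mu> k / (p j - p k) = - (\<mu> k / (p k - p j))"
      by (simp add: minus_divide_right)
    show ?thesis
      unfolding Aj Ak X_def using jk d by (simp add: algebra_simps add_divide_distrib)
  qed
  ultimately show ?thesis by simp
qed

section \<open>The resolvent of a CMV matrix\<close>

text \<open>Starting index 0 gives the whole factor L, and index 1 gives M without its leading entry
  1. Dropping the first 2 x 2 block yields the same object at \<open>k + 2\<close>, so one induction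
  serves both factors.\<close>

definition cmv_blocks :: "nat \<Rightarrow> (nat \<Rightarrow> complex) \<Rightarrow> nat \<Rightarrow> complex mat" where
  "cmv_blocks n \<alpha> k = diag_block_mat (map (Xi n \<alpha>) (filter (\<lambda>i. even i = even k) [k..<n]))"

lemma dim_Xi [simp]:
  "dim_row (Xi n \<alpha> k) = (if k < n - 1 then 2 else 1)"
  "dim_col (Xi n \<alpha> k) = (if k < n - 1 then 2 else 1)"
  by (auto simp: Xi_def mat_of_rows_list_def)

lemma cmv_blocks_end [simp]: "cmv_blocks n \<alpha> n = 0\<^sub>m 0 0"
  by (simp add: cmv_blocks_def)

lemma cmv_blocks_last [simp]: "0 < n \<Longrightarrow> cmv_blocks n \<alpha> (n - Suc 0) = Xi n \<alpha> (n - Suc 0)"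
  by (cases n) (simp_all add: cmv_blocks_def del: diag_block_mat.simps)

lemma cmv_blocks_unfold:
  assumes "k < n - 1"
  shows "cmv_blocks n \<alpha> k = four_block_mat (Xi n \<alpha> k)
           (0\<^sub>m 2 (dim_col (cmv_blocks n \<alpha> (k + 2))))
           (0\<^sub>m (dim_row (cmv_blocks n \<alpha> (k + 2))) 2) (cmv_blocks n \<alpha> (k + 2))"
proof -
  have "[k..<n] = k # Suc k # [k+2..<n]"
    using assms by (simp add: upt_conv_Cons)
  then show ?thesis using assms by (simp add: cmv_blocks_def Let_def)
qed

lemma cmv_blocks_carrier: "k \<le> n \<Longrightarrow> cmv_blocks n \<alpha> k \<in> carrier_mat (n - k) (n - k)"
proof (induction "n - k" arbitrary: k rule: less_induct)
  case less
  consider "k = n" | "0 < n" "k = n - 1" | "k < n - 1" using less.prems by linarith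
  then show ?case
  proof cases
    case 3
    then have "cmv_blocks n \<alpha> (k + 2) \<in> carrier_mat (n - (k + 2)) (n - (k + 2))"
      by (intro less.hyps) auto
    then show ?thesis using 3 unfolding cmv_blocks_unfold[OF 3] by auto
  qed auto
qed

lemma cmv_blocks_step:
  assumes "k < n - 1"
  shows "cmv_blocks n \<alpha> k = four_block_mat (Xi n \<alpha> k) (0\<^sub>m 2 (n - (k + 2)))
           (0\<^sub>m (n - (k + 2)) 2) (cmv_blocks n \<alpha> (k + 2))"
proof -
  have "k + 2 \<le> n" using assms by simp
  from cmv_blocks_carrier[OF this, of \<alpha>] show ?thesis
    unfolding cmv_blocks_unfold[OF assms] by simp
qed

text \<open>The action of \<open>cmv_blocks n \<alpha> k\<close>, with coordinates numbered from \<open>k\<close>.\<close>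

definition block_apply ::
    "nat \<Rightarrow> (nat \<Rightarrow> complex) \<Rightarrow> nat \<Rightarrow> (nat \<Rightarrow> complex) \<Rightarrow> nat \<Rightarrow> complex" where
  "block_apply n \<alpha> k f i =
     (if even i = even k
      then cnj (\<alpha> i) * f i + (if i < n - 1 then of_real (rho \<alpha> i) * f (Suc i) else 0)
      else of_real (rho \<alpha> (i - 1)) * f (i - 1) - \<alpha> (i - 1) * f i)"

lemma cmv_blocks_mult_vec:
  assumes "k \<le> n"
  shows "cmv_blocks n \<alpha> k *\<^sub>v Matrix.vec (n - k) (\<lambda>a. f (a + k))
       = Matrix.vec (n - k) (\<lambda>a. block_apply n \<alpha> k f (a + k))"
  using assms
proof (induction "n - k" arbitrary: k rule: less_induct)
  case less
  consider "k = n" | "0 < n" "k = n - 1" | "k < n - 1" using less.prems by linarith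
  then show ?case
  proof cases
    case 1
    then show ?thesis by (intro eq_vecI) auto
  next
    case 2
    then show ?thesis
      by (intro eq_vecI)
        (auto simp: Xi_def mat_of_rows_list_def scalar_prod_def block_apply_def
          row_def)
  next
    case 3
    let ?m = "n - (k + 2)"
    have m: "n - k = 2 + ?m" using 3 by simp
    have split: "Matrix.vec (n - k) (\<lambda>a. g (a + k))
       = Matrix.vec 2 (\<lambda>a. g (a + k)) @\<^sub>v Matrix.vec ?m (\<lambda>a. g (a + (k + 2)))" for g :: "nat \<Rightarrow> complex"
      using 3 by (intro eq_vecI) (auto intro!: arg_cong[of _ _ g])
    have Xi: "Xi n \<alpha> k \<in> carrier_mat 2 2" using 3 by auto
    have "cmv_blocks n \<alpha> k *\<^sub>v Matrix.vec (n - k) (\<lambda>a. f (a + k))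
      = (Xi n \<alpha> k *\<^sub>v Matrix.vec 2 (\<lambda>a. f (a + k)))
        @\<^sub>v (cmv_blocks n \<alpha> (k + 2) *\<^sub>v Matrix.vec ?m (\<lambda>a. f (a + (k + 2))))"
      unfolding split cmv_blocks_step[OF 3]
      by (rule mult_mat_vec_split[OF Xi]) (use 3 cmv_blocks_carrier[of "k + 2" n] in auto)
    also have "cmv_blocks n \<alpha> (k + 2) *\<^sub>v Matrix.vec ?m (\<lambda>a. f (a + (k + 2)))
       = Matrix.vec ?m (\<lambda>a. block_apply n \<alpha> (k + 2) f (a + (k + 2)))"
      by (rule less.hyps) (use 3 in auto)
    \<comment> \<open>\<open>block_apply\<close> sees \<open>k\<close> only through its
      parity.\<close>
    also have "block_apply n \<alpha> (k + 2) f = block_apply n \<alpha> k f"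
      by (simp add: block_apply_def fun_eq_iff)
    also have "Xi n \<alpha> k *\<^sub>v Matrix.vec 2 (\<lambda>a. f (a + k)) = Matrix.vec 2 (\<lambda>a. block_apply n \<alpha> k f (a + k))"
    proof (rule eq_vecI)
      have two: "{0..<2::nat} = {0, 1}" by auto
      fix i assume "i < dim_vec (Matrix.vec 2 (\<lambda>a. block_apply n \<alpha> k f (a + k)))"
      then have "i = 0 \<or> i = 1" by auto
      then show "(Xi n \<alpha> k *\<^sub>v Matrix.vec 2 (\<lambda>a. f (a + k))) $ i
          = Matrix.vec 2 (\<lambda>a. block_apply n \<alpha> k f (a + k)) $ i"
        using 3 by (auto simp: Xi_def mat_of_rows_list_def scalar_prod_def block_apply_def
            two)
    qed (use 3 in auto)
    finally show ?thesis unfolding split .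
  qed
qed

lemma cmv_L_eq_blocks: "cmv_L n \<alpha> = cmv_blocks n \<alpha> 0"
  by (simp add: cmv_L_def cmv_blocks_def)

lemma cmv_M_eq_blocks:
  assumes "0 < n"
  shows "cmv_M n \<alpha> = four_block_mat (1\<^sub>m 1) (0\<^sub>m 1 (n - 1)) (0\<^sub>m (n - 1) 1) (cmv_blocks n \<alpha> 1)"
proof -
  have "filter odd [0..<n] = filter (\<lambda>i. even i = even (1::nat)) [1..<n]"
    using assms by (simp add: upt_conv_Cons)
  then have "cmv_M n \<alpha> = four_block_mat (1\<^sub>m 1) (0\<^sub>m 1 (dim_col (cmv_blocks n \<alpha> 1)))
      (0\<^sub>m (dim_row (cmv_blocks n \<alpha> 1)) 1) (cmv_blocks n \<alpha> 1)"
    by (simp add: cmv_M_def cmv_blocks_def Let_def)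
  then show ?thesis using cmv_blocks_carrier[of 1 n \<alpha>] assms by simp
qed

lemma cmv_carrier:
  assumes "0 < n"
  shows "cmv_L n \<alpha> \<in> carrier_mat n n" "cmv_M n \<alpha> \<in> carrier_mat n n" "cmv n \<alpha> \<in> carrier_mat n n"
proof -
  show L: "cmv_L n \<alpha> \<in> carrier_mat n n"
    using cmv_blocks_carrier[of 0 n] by (simp add: cmv_L_eq_blocks)
  show M: "cmv_M n \<alpha> \<in> carrier_mat n n"
    using four_block_carrier_mat[of "1\<^sub>m 1 :: complex mat" 1 1 "cmv_blocks n \<alpha> 1" "n - 1" "n - 1"]
      cmv_blocks_carrier[of 1 n \<alpha>] assms by (simp add: cmv_M_eq_blocks)
  show "cmv n \<alpha> \<in> carrier_mat n n" unfolding cmv_def using L M by simp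
qed

lemma cmv_mult_vec:
  assumes "0 < n"
  shows "cmv n \<alpha> *\<^sub>v Matrix.vec n f
    = Matrix.vec n (block_apply n \<alpha> 0 (\<lambda>i. if i = 0 then f 0 else block_apply n \<alpha> 1 f i))"
proof -
  \<comment> \<open>The vector M f; coordinate 0 is fixed because the block with index -1 is
    [1].\<close>
  define y where "y = (\<lambda>i. if i = 0 then f 0 else block_apply n \<alpha> 1 f i)"
  have split: "Matrix.vec n g = Matrix.vec 1 g @\<^sub>v Matrix.vec (n - 1) (\<lambda>a. g (a + 1))"
    for g :: "nat \<Rightarrow> complex"
    using assms by (intro eq_vecI) auto
  have "cmv_M n \<alpha> *\<^sub>v Matrix.vec n f
      = (1\<^sub>m 1 *\<^sub>v Matrix.vec 1 f) @\<^sub>v (cmv_blocks n \<alpha> 1 *\<^sub>v Matrix.vec (n - 1) (\<lambda>a. f (a + 1)))"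
    unfolding split[of f] cmv_M_eq_blocks[OF assms]
    by (rule mult_mat_vec_split) (use assms cmv_blocks_carrier[of 1 n] in auto)
  also have "cmv_blocks n \<alpha> 1 *\<^sub>v Matrix.vec (n - 1) (\<lambda>a. f (a + 1))
      = Matrix.vec (n - 1) (\<lambda>a. block_apply n \<alpha> 1 f (a + 1))"
    by (rule cmv_blocks_mult_vec) (use assms in auto)
  also have "\<dots> = Matrix.vec (n - 1) (\<lambda>a. y (a + 1))" by (simp add: y_def)
  also have "1\<^sub>m 1 *\<^sub>v Matrix.vec 1 f = Matrix.vec 1 y" by (auto simp: y_def)
  also have "Matrix.vec 1 y @\<^sub>v Matrix.vec (n - 1) (\<lambda>a. y (a + 1)) = Matrix.vec n y"
    by (rule split[symmetric])
  finally have M: "cmv_M n \<alpha> *\<^sub>v Matrix.vec n f = Matrix.vec n y" .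
  have "cmv n \<alpha> *\<^sub>v Matrix.vec n f = cmv_L n \<alpha> *\<^sub>v Matrix.vec n y"
    unfolding cmv_def using cmv_carrier[OF assms, of \<alpha>] M by (simp add: assoc_mult_mat_vec[of _ n n _ n])
  also have "\<dots> = Matrix.vec n (block_apply n \<alpha> 0 y)"
    using cmv_blocks_mult_vec[of 0 n \<alpha> y] by (simp add: cmv_L_eq_blocks)
  finally show ?thesis by (simp add: y_def)
qed

section \<open>Determinants of CMV matrices\<close>

lemma det_Xi:
  assumes "cmod (\<alpha> k) \<le> 1" "k < n - 1"
  shows "Determinant.det (Xi n \<alpha> k) = - 1"
proof -
  have c: "Xi n \<alpha> k \<in> carrier_mat 2 2" using assms by auto
  have rho: "complex_of_real (rho \<alpha> k) * complex_of_real (rho \<alpha> k) = 1 - \<alpha> k * cnj (\<alpha> k)"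
  proof -
    have "complex_of_real ((rho \<alpha> k)\<^sup>2) = 1 - \<alpha> k * cnj (\<alpha> k)"
      using assms by (simp add: rho_def power_le_one complex_norm_square[symmetric])
    then show ?thesis by (simp add: power2_eq_square)
  qed
  have two: "{..<2::nat} = {0, 1}" by auto
  have minor: "Determinant.det (mat_delete (Xi n \<alpha> k) i 0) = Xi n \<alpha> k $$ (1 - i, 1)"
    if "i \<in> {0, 1}" for i
  proof -
    have "mat_delete (Xi n \<alpha> k) i 0 \<in> carrier_mat 1 1" using c by (auto simp: mat_delete_def)
    then have "Determinant.det (mat_delete (Xi n \<alpha> k) i 0) = mat_delete (Xi n \<alpha> k) i 0 $$ (0, 0)"
      by (rule det_single)
    then show ?thesis using that assms(2) by (auto simp: mat_delete_def)
  qed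
  have entries: "Xi n \<alpha> k $$ (0, 0) = cnj (\<alpha> k)" "Xi n \<alpha> k $$ (0, 1) = of_real (rho \<alpha> k)"
    "Xi n \<alpha> k $$ (1, 0) = of_real (rho \<alpha> k)" "Xi n \<alpha> k $$ (1, 1) = - \<alpha> k"
    using assms(2) by (simp_all add: Xi_def mat_of_rows_list_def)
  have "Determinant.det (Xi n \<alpha> k) = (\<Sum>i<2. Xi n \<alpha> k $$ (i, 0) * cofactor (Xi n \<alpha> k) i 0)"
    by (rule laplace_expansion_column[OF c]) simp
  also have "\<dots> = cnj (\<alpha> k) * - \<alpha> k - of_real (rho \<alpha> k) * of_real (rho \<alpha> k)"
    unfolding two by (simp add: cofactor_def minor entries[simplified])
  also have "\<dots> = - 1" unfolding rho by (simp add: mult.commute)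
  finally show ?thesis .
qed

text \<open>Every 2 x 2 block has determinant -1 whatever its coefficient, so only the final 1 x 1
  block distinguishes the determinants. This keeps perturbations of the other coefficients inside
  the manifold.\<close>

lemma det_cmv_blocks_cong:
  assumes "k \<le> n" "\<And>i. i < n - 1 \<Longrightarrow> cmod (\<alpha> i) \<le> 1" "\<And>i. i < n - 1 \<Longrightarrow> cmod (\<beta> i) \<le> 1"
    and "\<alpha> (n - 1) = \<beta> (n - 1)"
  shows "Determinant.det (cmv_blocks n \<alpha> k) = Determinant.det (cmv_blocks n \<beta> k)"
  using assms(1)
proof (induction "n - k" arbitrary: k rule: less_induct)
  case less
  consider "k = n" | "0 < n" "k = n - 1" | "k < n - 1" using less.prems by linarith
  then show ?case
  proof cases
    case 2
    then show ?thesis using assms(4) by (simp add: Xi_def)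
  next
    case 3
    have det: "Determinant.det (cmv_blocks n \<gamma> k)
        = Determinant.det (Xi n \<gamma> k) * Determinant.det (cmv_blocks n \<gamma> (k + 2))" for \<gamma>
      unfolding cmv_blocks_step[OF 3]
      by (rule det_four_block_mat_upper_right_zero)
        (use 3 cmv_blocks_carrier[of "k + 2" n] in auto)
    have "Determinant.det (cmv_blocks n \<alpha> (k + 2)) = Determinant.det (cmv_blocks n \<beta> (k + 2))"
      by (rule less.hyps) (use 3 in auto)
    then show ?thesis unfolding det using 3 assms(2,3) by (simp add: det_Xi)
  qed simp
qed

lemma det_cmv_cong:
  assumes n: "0 < n"
    and "\<And>i. i < n - 1 \<Longrightarrow> cmod (\<alpha> i) \<le> 1" "\<And>i. i < n - 1 \<Longrightarrow> cmod (\<beta> i) \<le> 1"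
    and "\<alpha> (n - 1) = \<beta> (n - 1)"
  shows "Determinant.det (cmv n \<alpha>) = Determinant.det (cmv n \<beta>)"
proof -
  have "Determinant.det (cmv n \<gamma>)
      = Determinant.det (cmv_blocks n \<gamma> 0) * Determinant.det (cmv_blocks n \<gamma> 1)" for \<gamma>
  proof -
    have "Determinant.det (cmv_M n \<gamma>) = Determinant.det (1\<^sub>m 1) * Determinant.det (cmv_blocks n \<gamma> 1)"
      unfolding cmv_M_eq_blocks[OF n]
      by (rule det_four_block_mat_upper_right_zero) (use n cmv_blocks_carrier[of 1 n] in auto)
    then show ?thesis
      unfolding cmv_def using cmv_carrier(1,2)[OF n, of \<gamma>]
      by (simp add: det_mult[of _ n] cmv_L_eq_blocks)
  qed
  then show ?thesis using det_cmv_blocks_cong[of 0 n \<alpha> \<beta>] det_cmv_blocks_cong[of 1 n \<alpha> \<beta>] assms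
    by simp
qed

text \<open>A scattering relation: the block sends (q, q') to (p, p'). Closing the lower channel by
  q' = c p' turns the block into the Moebius map with coefficient \<open>a\<close>, applied to the
  ratio \<open>c\<close>.\<close>

lemma moebius_elimination:
  fixes a c q q' p p' r :: complex
  assumes "p = cnj a * q + r * q'" "p' = r * q - a * q'" "q' = c * p'"
    and nz: "1 + a * c \<noteq> 0" and r: "r\<^sup>2 = 1 - a * cnj a"
  shows "p = (cnj a + c) / (1 + a * c) * q"
proof -
  have "c * p' = c * r * q - a * c * q'" unfolding assms(2) by (simp add: algebra_simps)
  then have "q' + a * c * q' = c * r * q" unfolding assms(3)[symmetric] by (simp add: eq_diff_eq)
  then have q': "q' * (1 + a * c) = c * r * q" by (simp add: distrib_left mult.commute)
  have "p * (1 + a * c) = cnj a * (1 + a * c) * q + r * (q' * (1 + a * c))"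
    unfolding assms(1) by (simp add: algebra_simps)
  also have "\<dots> = cnj a * (1 + a * c) * q + r * (c * r * q)" unfolding q' ..
  also have "\<dots> = (cnj a + r\<^sup>2 * c + a * cnj a * c) * q" by (simp add: algebra_simps power2_eq_square)
  also have "\<dots> = (cnj a + c) * q" unfolding r by (simp add: algebra_simps)
  finally show ?thesis using nz by (simp add: field_simps)
qed

text \<open>Eliminating the coordinates from the last one upwards in \<open>(z - C) x = b e\<^sub>1\<close>, with \<open>y = M x\<close>:
  the ratio \<open>y k / x k\<close> for odd \<open>k\<close>, and \<open>z x k / y k\<close> for even \<open>k\<close>, is a Schur function.\<close>

lemma schur_fn_of_solution:
  assumes n: "0 < n" and adm: "admissible \<alpha> 0 n" and z: "1 \<le> cmod z"
    and y0: "y 0 = x 0" and y: "\<And>i. 0 < i \<Longrightarrow> i < n \<Longrightarrow> y i = block_apply n \<alpha> 1 x i"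
    and x: "\<And>i. i < n \<Longrightarrow> z * x i - (if i = 0 then b else 0) = block_apply n \<alpha> 0 y i"
  shows "(z - schur_fn \<alpha> z 0 n) * x 0 = b"
proof -
  have z0: "z \<noteq> 0" using z by auto
  have ratio: "if odd k then y k = schur_fn \<alpha> z k (Suc m) * x k
         else z * x k - (if k = 0 then b else 0) = schur_fn \<alpha> z k (Suc m) * y k"
    if "k + Suc m = n" for k m
    using that
  proof (induction m arbitrary: k)
    case 0
    then have k: "n = Suc k" by simp
    have "odd k \<Longrightarrow> 0 < k" by (cases k) auto
    then show ?case
      using y[of k] x[of k] unfolding k by (auto simp: block_apply_def)
  next
    case (Suc m)
    have adm': "admissible \<alpha> k (Suc (Suc m))"
      using adm Suc.prems by (auto simp: admissible_def)
    \<comment> \<open>The same quotient closes both parities: for odd \<open>k\<close> it is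
      \<open>x (Suc k) / y (Suc k)\<close>, for even \<open>k\<close> it is
      \<open>y (Suc k) / (z * x (Suc k))\<close>. This is where the recursion acquires its 1 /
      z.\<close>
    define c where "c = schur_fn \<alpha> z (Suc k) (Suc m) / z"
    have nz: "1 + \<alpha> k * c \<noteq> 0"
      unfolding c_def by (rule schur_fn_denom_nonzero[OF adm' z])
    have k: "k < n - 1" "Suc k < n" using Suc.prems by auto
    have rho: "(complex_of_real (rho \<alpha> k))\<^sup>2 = 1 - \<alpha> k * cnj (\<alpha> k)"
    proof -
      have "cmod (\<alpha> k) \<le> 1" using adm k by (auto simp: admissible_def)
      then have "complex_of_real ((rho \<alpha> k)\<^sup>2) = 1 - \<alpha> k * cnj (\<alpha> k)"
        by (simp add: rho_def power_le_one complex_norm_square[symmetric])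
      then show ?thesis by simp
    qed
    have IH: "if odd (Suc k) then y (Suc k) = schur_fn \<alpha> z (Suc k) (Suc m) * x (Suc k)
         else z * x (Suc k) - (if Suc k = 0 then b else 0) = schur_fn \<alpha> z (Suc k) (Suc m) * y (Suc k)"
      by (rule Suc.IH) (use Suc.prems in simp)
    have sf: "schur_fn \<alpha> z k (Suc (Suc m)) = (cnj (\<alpha> k) + c) / (1 + \<alpha> k * c)"
      by (simp add: c_def)
    show ?case
    proof (cases "odd k")
      case True
      then have "0 < k" by (cases k) auto
      have "y k = cnj (\<alpha> k) * x k + rho \<alpha> k * x (Suc k)"
        using y[of k] k True \<open>0 < k\<close> by (simp add: block_apply_def)
      moreover have "y (Suc k) = rho \<alpha> k * x k - \<alpha> k * x (Suc k)"
        using y[of "Suc k"] k True by (simp add: block_apply_def)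
      moreover have "x (Suc k) = c * y (Suc k)"
        using IH True z0 by (simp add: c_def nonzero_eq_divide_eq mult.commute del: schur_fn.simps)
      ultimately have "y k = (cnj (\<alpha> k) + c) / (1 + \<alpha> k * c) * x k"
        using nz rho by (rule moebius_elimination)
      then show ?thesis using True sf by simp
    next
      case False
      have "z * x k - (if k = 0 then b else 0) = cnj (\<alpha> k) * y k + rho \<alpha> k * y (Suc k)"
        using x[of k] k False by (simp add: block_apply_def)
      moreover have "z * x (Suc k) = rho \<alpha> k * y k - \<alpha> k * y (Suc k)"
        using x[of "Suc k"] k False by (simp add: block_apply_def)
      moreover have "y (Suc k) = c * (z * x (Suc k))"
        using IH False z0 by (simp add: c_def)
      ultimately have "z * x k - (if k = 0 then b else 0) = (cnj (\<alpha> k) + c) / (1 + \<alpha> k * c) * y k"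
        using nz rho by (rule moebius_elimination)
      then show ?thesis using False sf by simp
    qed
  qed
  from ratio[of 0 "n - 1"] n y0 show ?thesis by (simp add: algebra_simps)
qed

section \<open>The secular equation of the spectral measure\<close>

lemma verblunsky_admissible:
  assumes "0 < n" "\<alpha> \<in> verblunsky n"
  shows "admissible \<alpha> 0 n"
  unfolding admissible_def
proof (intro allI impI)
  fix i assume "i < 0 + n"
  then consider "i < n - 1" | "i = n - 1" by linarith
  then show "cmod (\<alpha> i) \<le> 1 \<and> (Suc i < 0 + n \<longrightarrow> cmod (\<alpha> i) < 1)"
    using assms by cases (auto simp: verblunsky_def intro: less_imp_le)
qed

text \<open>The functional calculus is applied to h(x) = 1 / (x - w), whose value at the CMV matrix
  C is the inverse \<open>B\<close> of \<open>char_matrix\<close>, that is of C - w. Its (0, 0)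
  entry is computed twice: from the spectral measure, and by eliminating coordinates in the linear
  system.\<close>

lemma spectral_labelling_secular:
  assumes n: "0 < n" and \<alpha>: "\<alpha> \<in> verblunsky n" and lab: "spectral_labelling n \<alpha> \<theta> \<mu>"
    and w: "1 \<le> cmod w" and nev: "w \<notin> (\<lambda>j. cis (\<theta> j)) ` {1..n}"
  shows "(w - schur_fn \<alpha> w 0 n) * (\<Sum>j=1..n. complex_of_real (\<mu> j) / (w - cis (\<theta> j))) = 1"
proof -
  let ?C = "cmv n \<alpha>" and ?e = "unit_vec n 0 :: complex Matrix.vec"
  have C: "?C \<in> carrier_mat n n" using cmv_carrier(3)[OF n] .
  then have K: "char_matrix ?C w \<in> carrier_mat n n" by simp
  have ev: "{z. eigenvalue ?C z} = (\<lambda>j. cis (\<theta> j)) ` {1..n}"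
    using lab unfolding spectral_labelling_def bij_betw_def by simp
  then have "\<not> eigenvalue ?C w" using nev by auto
  then have "Determinant.det (char_matrix ?C w) \<noteq> 0" using eigenvalue_det[OF C] by simp
  from det_non_zero_imp_unit[OF K this, of "()"] obtain B where B: "B \<in> carrier_mat n n"
    and BK: "B * char_matrix ?C w = 1\<^sub>m n" and KB: "char_matrix ?C w * B = 1\<^sub>m n"
    unfolding Units_def ring_mat_def by auto
  have Kv: "char_matrix ?C w *\<^sub>v v = ?C *\<^sub>v v - w \<cdot>\<^sub>v v" if v: "v \<in> carrier_vec n" for v
  proof -
    have "char_matrix ?C w *\<^sub>v v = ?C *\<^sub>v v + ((- w) \<cdot>\<^sub>m 1\<^sub>m n) *\<^sub>v v"
      unfolding char_matrix_def using C v by (simp add: add_mult_distrib_mat_vec[of _ n n])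
    also have "((- w) \<cdot>\<^sub>m 1\<^sub>m n) *\<^sub>v v = (- w) \<cdot>\<^sub>v v"
      using v by (auto simp: scalar_prod_def if_distrib if_distribR cong: if_cong intro!: eq_vecI)
    finally show ?thesis using C v by (intro eq_vecI) auto
  qed
  have "is_mat_fun (\<lambda>x. 1 / (x - w)) ?C B"
    unfolding is_mat_fun_def
  proof (intro conjI allI impI)
    show "B \<in> carrier_mat (dim_row ?C) (dim_row ?C)" using B C by simp
    fix v z assume vz: "eigenvector ?C v z"
    then have v: "v \<in> carrier_vec n" and Cv: "?C *\<^sub>v v = z \<cdot>\<^sub>v v"
      using C unfolding eigenvector_def by auto
    have "eigenvalue ?C z" using vz unfolding eigenvalue_def by blast
    then have zw: "z - w \<noteq> 0" using ev nev by auto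
    have "v = (B * char_matrix ?C w) *\<^sub>v v" using BK v by simp
    also have "\<dots> = B *\<^sub>v (char_matrix ?C w *\<^sub>v v)" by (rule assoc_mult_mat_vec[OF B K v])
    also have "char_matrix ?C w *\<^sub>v v = (z - w) \<cdot>\<^sub>v v"
      unfolding Kv[OF v] Cv using v by (intro eq_vecI) (auto simp: algebra_simps)
    also have "B *\<^sub>v ((z - w) \<cdot>\<^sub>v v) = (z - w) \<cdot>\<^sub>v (B *\<^sub>v v)"
      using B v by (rule mult_mat_vec)
    finally have "1 / (z - w) \<cdot>\<^sub>v v = 1 / (z - w) \<cdot>\<^sub>v ((z - w) \<cdot>\<^sub>v (B *\<^sub>v v))" by simp
    then show "B *\<^sub>v v = 1 / (z - w) \<cdot>\<^sub>v v"
      using zw by (simp add: smult_smult_assoc)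
  qed
  then have sum: "(B *\<^sub>v ?e) \<bullet>c ?e = (\<Sum>j=1..n. 1 / (cis (\<theta> j) - w) * complex_of_real (\<mu> j))"
    using lab unfolding spectral_labelling_def by blast
  define x where "x = (\<lambda>i. (B *\<^sub>v ?e) $ i)"
  define y where "y = (\<lambda>i. if i = 0 then x 0 else block_apply n \<alpha> 1 x i)"
  have Be: "B *\<^sub>v ?e \<in> carrier_vec n" using B by simp
  have vx: "B *\<^sub>v ?e = Matrix.vec n x" using Be B by (intro eq_vecI) (auto simp: x_def)
  have "conjugate ?e = ?e" by (intro eq_vecI) (auto simp: unit_vec_def)
  then have x0: "(B *\<^sub>v ?e) \<bullet>c ?e = x 0" using Be n by (simp add: x_def)
  have "?e = (char_matrix ?C w * B) *\<^sub>v ?e" using KB by simp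
  also have "\<dots> = char_matrix ?C w *\<^sub>v (B *\<^sub>v ?e)" by (rule assoc_mult_mat_vec[OF K B]) simp
  also have "\<dots> = ?C *\<^sub>v (B *\<^sub>v ?e) - w \<cdot>\<^sub>v (B *\<^sub>v ?e)" by (rule Kv[OF Be])
  also have "\<dots> = Matrix.vec n (block_apply n \<alpha> 0 y) - w \<cdot>\<^sub>v Matrix.vec n x"
    unfolding vx cmv_mult_vec[OF n] y_def ..
  finally have e: "?e = Matrix.vec n (block_apply n \<alpha> 0 y) - w \<cdot>\<^sub>v Matrix.vec n x" .
  \<comment> \<open>\<open>char_matrix\<close> is C - w, so \<open>x\<close> solves (w - C) x = -
    e_1: the elimination lemma is used with b = - 1.\<close>
  have "(w - schur_fn \<alpha> w 0 n) * x 0 = - 1"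
  proof (rule schur_fn_of_solution[OF n verblunsky_admissible[OF n \<alpha>] w])
    fix i assume i: "i < n"
    have "?e $ i = block_apply n \<alpha> 0 y i - w * x i"
      unfolding e using i by simp
    then show "w * x i - (if i = 0 then - 1 else 0) = block_apply n \<alpha> 0 y i"
      using i by (auto simp: algebra_simps split: if_splits)
  qed (simp_all add: y_def)
  moreover have "x 0 = - (\<Sum>j=1..n. complex_of_real (\<mu> j) / (w - cis (\<theta> j)))"
    unfolding x0[symmetric] sum sum_negf[symmetric]
    by (rule sum.cong) (auto simp: minus_divide_right)
  ultimately show ?thesis by simp
qed

section \<open>Brackets of the spectral masses\<close>

text \<open>The secular equation excludes the eigenvalues themselves. Multiplied by w - p j it reads
  E(w) (\<mu> j + o(1)) = w - p j as \<open>w\<close> tends to p j from outside; continuity of the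
  Schur function up to the circle and \<mu> j > 0 force E to vanish there.\<close>

lemma spectral_labelling_root:
  assumes n: "0 < n" and \<alpha>: "\<alpha> \<in> verblunsky n" and lab: "spectral_labelling n \<alpha> \<theta> \<mu>"
    and j: "j \<in> {1..n}"
  shows "cis (\<theta> j) - schur_fn \<alpha> (cis (\<theta> j)) 0 n = 0"
proof -
  define p where "p = (\<lambda>i. cis (\<theta> i))"
  let ?F = "at (p j) within {z. 1 < cmod z}"
  let ?E = "\<lambda>w. w - schur_fn \<alpha> w 0 n"
  let ?S = "\<lambda>w. \<Sum>i\<in>{1..n}. complex_of_real (\<mu> i) / (w - p i)"
  have p: "cmod (p i) = 1" for i by (simp add: p_def)
  have inj: "inj_on p {1..n}" and pos: "0 < \<mu> j"
    using lab j unfolding spectral_labelling_def p_def bij_betw_def by auto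
  have id: "((\<lambda>w. w - p j) \<longlongrightarrow> 0) ?F"
    by (rule tendsto_eq_intros | simp)+
  have "continuous_on {z. 1 \<le> cmod z} ?E"
    by (intro continuous_intros continuous_on_schur_fn verblunsky_admissible n \<alpha>)
  then have "(?E \<longlongrightarrow> ?E (p j)) (at (p j) within {z. 1 \<le> cmod z})"
    using p by (simp add: continuous_on_def)
  then have E: "(?E \<longlongrightarrow> ?E (p j)) ?F"
    by (rule tendsto_within_subset) auto
  obtain L where L: "((\<lambda>w. (\<Sum>i\<in>{1..n}. complex_of_real (\<mu> i) / (w - p i) + 0 / (w - p i)\<^sup>2)
      - 0 / (w - p j)\<^sup>2 - complex_of_real (\<mu> j) / (w - p j)) \<longlongrightarrow> L) ?F"
    using principal_part_sum_poles[OF _ j inj, of "\<lambda>i. complex_of_real (\<mu> i)" "\<lambda>_. 0"]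
    unfolding principal_part_def by auto
  have "((\<lambda>w. ?E w * ((?S w - complex_of_real (\<mu> j) / (w - p j)) * (w - p j) + complex_of_real (\<mu> j)))
      \<longlongrightarrow> ?E (p j) * (L * 0 + complex_of_real (\<mu> j))) ?F"
    using L by (intro tendsto_intros E id) simp
  moreover have "eventually (\<lambda>w. ?E w * ((?S w - complex_of_real (\<mu> j) / (w - p j)) * (w - p j)
      + complex_of_real (\<mu> j)) = w - p j) ?F"
    unfolding eventually_at_filter
  proof (intro always_eventually allI impI)
    fix w assume w: "w \<noteq> p j" "w \<in> {z. 1 < cmod z}"
    have "w \<notin> p ` {1..n}" using w p by auto
    then have "?E w * ?S w = 1"
      using spectral_labelling_secular[OF n \<alpha> lab, of w] w by (simp add: p_def)
    moreover have "(?S w - complex_of_real (\<mu> j) / (w - p j)) * (w - p j) + complex_of_real (\<mu> j)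
        = ?S w * (w - p j)"
      using w by (simp add: left_diff_distrib)
    ultimately show "?E w * ((?S w - complex_of_real (\<mu> j) / (w - p j)) * (w - p j)
      + complex_of_real (\<mu> j)) = w - p j"
      by (metis mult.assoc mult_1)
  qed
  ultimately have "((\<lambda>w. w - p j) \<longlongrightarrow> ?E (p j) * (L * 0 + complex_of_real (\<mu> j))) ?F"
    by (rule Lim_transform_eventually)
  then have "?E (p j) * (L * 0 + complex_of_real (\<mu> j)) = 0"
    using tendsto_unique[OF at_within_outside_disk_nontrivial[OF p]] id by blast
  then show ?thesis using pos by (simp add: p_def)
qed

text \<open>For \<open>j < n - 1\<close> the last coefficient, hence the determinant, is unchanged
  along the line, while the open condition on the modulus of coefficient \<open>j\<close> survives
  for small \<open>t\<close>.\<close>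

lemma coordinate_line_in_open:
  assumes U: "openin (top_of_set (cmv_manifold n d)) U" and \<alpha>: "\<alpha> \<in> U" and j: "j < n - 1"
  obtains \<epsilon> where "0 < \<epsilon>"
    "\<And>t::real. \<bar>t\<bar> < \<epsilon> \<Longrightarrow> \<alpha>(j := \<alpha> j + of_real t * \<delta>) \<in> U"
proof -
  define \<gamma> where "\<gamma> = (\<lambda>t::real. \<alpha>(j := \<alpha> j + of_real t * \<delta>))"
  obtain T where T: "open T" "U = cmv_manifold n d \<inter> T"
    using U unfolding openin_open by blast
  have \<alpha>v: "\<alpha> \<in> verblunsky n" and det: "Determinant.det (cmv n \<alpha>) = d" and \<alpha>T: "\<alpha> \<in> T"
    using \<alpha> T by (auto simp: cmv_manifold_def)
  have "continuous_on UNIV \<gamma>"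
  proof (rule continuous_on_coordinatewise_then_product)
    fix i
    show "continuous_on UNIV (\<lambda>t. \<gamma> t i)"
      by (cases "i = j") (auto simp: \<gamma>_def intro!: continuous_intros)
  qed
  then have "open (\<gamma> -` T)" using T(1) by (rule open_vimage[rotated])
  moreover have "open {t::real. cmod (\<alpha> j + of_real t * \<delta>) < 1}"
    by (intro open_Collect_less continuous_intros)
  ultimately have "open (\<gamma> -` T \<inter> {t. cmod (\<alpha> j + of_real t * \<delta>) < 1})" by (rule open_Int)
  moreover have "0 \<in> \<gamma> -` T \<inter> {t. cmod (\<alpha> j + of_real t * \<delta>) < 1}"
    using \<alpha>T \<alpha>v j by (simp add: \<gamma>_def verblunsky_def)
  ultimately obtain \<epsilon> where e: "\<epsilon> > 0"
    "ball 0 \<epsilon> \<subseteq> \<gamma> -` T \<inter> {t. cmod (\<alpha> j + of_real t * \<delta>) < 1}"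
    unfolding open_contains_ball by blast
  show thesis
  proof (rule that[OF e(1)])
    fix t :: real assume "\<bar>t\<bar> < \<epsilon>"
    then have "t \<in> ball 0 \<epsilon>" by simp
    then have t: "\<gamma> t \<in> T" "cmod (\<alpha> j + of_real t * \<delta>) < 1" using e by auto
    have v: "\<gamma> t \<in> verblunsky n"
      using \<alpha>v t(2) j by (auto simp: \<gamma>_def verblunsky_def)
    have "Determinant.det (cmv n (\<gamma> t)) = Determinant.det (cmv n \<alpha>)"
    proof (rule det_cmv_cong)
      show "0 < n" using j by simp
      show "\<And>i. i < n - 1 \<Longrightarrow> cmod (\<gamma> t i) \<le> 1" "\<And>i. i < n - 1 \<Longrightarrow> cmod (\<alpha> i) \<le> 1"
        using v \<alpha>v unfolding verblunsky_def by (auto intro: less_imp_le)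
      show "\<gamma> t (n - 1) = \<alpha> (n - 1)" using j by (auto simp: \<gamma>_def)
    qed
    then show "\<alpha>(j := \<alpha> j + of_real t * \<delta>) \<in> U"
      using v t(1) det T(2) by (simp add: cmv_manifold_def \<gamma>_def)
  qed
qed

text \<open>\<open>secular_curve\<close> applied along a coordinate line with E w t = w - e w; the
  sign in the derivative of E cancels the one in \<open>resolvent_derivative\<close>. The
  existential \<open>z'\<close> is the velocity of the eigenvalues.\<close>

lemma spectral_data_derivative:
  assumes n: "0 < n" and U: "openin (top_of_set (cmv_manifold n d)) U"
    and cont: "\<forall>i\<in>{1..n}. continuous_on U (\<theta> i)"
    and lab: "\<forall>\<gamma>\<in>U. spectral_labelling n \<gamma> (\<lambda>i. \<theta> i \<gamma>) (\<lambda>i. \<mu> i \<gamma>)"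
    and \<alpha>: "\<alpha> \<in> U" and j: "j < n - 1"
  shows "\<exists>z' \<mu>'. (\<forall>i\<in>{1..n}. ((\<lambda>t. \<mu> i (\<alpha>(j := \<alpha> j + of_real t * \<delta>))) has_real_derivative \<mu>' i) (at 0)) \<and>
     (\<forall>w. 1 < cmod w \<longrightarrow>
       (\<Sum>i\<in>{1..n}. of_real (\<mu>' i) / (w - cis (\<theta> i \<alpha>)) + of_real (\<mu> i \<alpha>) * z' i / (w - cis (\<theta> i \<alpha>))\<^sup>2)
       = (schur_d \<alpha> w j 0 n * \<delta> + schur_dbar \<alpha> w j 0 n * cnj \<delta>)
          * (\<Sum>i\<in>{1..n}. of_real (\<mu> i \<alpha>) / (w - cis (\<theta> i \<alpha>)))\<^sup>2)"
proof -
  obtain \<epsilon> where eps: "0 < \<epsilon>"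
    and inU: "\<And>t::real. \<bar>t\<bar> < \<epsilon> \<Longrightarrow> \<alpha>(j := \<alpha> j + of_real t * \<delta>) \<in> U"
    using coordinate_line_in_open[OF U \<alpha> j] by blast
  define \<gamma> where "\<gamma> = (\<lambda>t::real. \<alpha>(j := \<alpha> j + of_real t * \<delta>))"
  have \<gamma>U: "\<gamma> t \<in> U" if "\<bar>t\<bar> < \<epsilon>" for t using inU[OF that] by (simp add: \<gamma>_def)
  have \<gamma>0: "\<gamma> 0 = \<alpha>" by (simp add: \<gamma>_def)
  have UV: "\<beta> \<in> verblunsky n" if "\<beta> \<in> U" for \<beta>
    using openin_imp_subset[OF U] that by (auto simp: cmv_manifold_def)
  define E where "E = (\<lambda>w t. w - schur_fn (\<gamma> t) w 0 n)"
  have dE: "(E w has_vector_derivative - (schur_d \<alpha> w j 0 n * \<delta> + schur_dbar \<alpha> w j 0 n * cnj \<delta>)) (at 0)"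
    if "1 \<le> cmod w" for w
    using has_vector_derivative_diff[OF has_vector_derivative_const
        has_vector_derivative_schur_fn[OF verblunsky_admissible[OF n UV[OF \<alpha>]] that, of j \<delta>], of w]
    by (simp add: E_def \<gamma>_def)
  have c\<gamma>: "continuous_on {- \<epsilon><..<\<epsilon>} \<gamma>"
  proof (rule continuous_on_coordinatewise_then_product)
    fix i
    show "continuous_on {- \<epsilon><..<\<epsilon>} (\<lambda>t. \<gamma> t i)"
      by (cases "i = j") (auto simp: \<gamma>_def intro!: continuous_intros)
  qed
  interpret secular_curve "{1..n}" \<epsilon> "\<lambda>t i. cis (\<theta> i (\<gamma> t))" "\<lambda>t i. complex_of_real (\<mu> i (\<gamma> t))" E
  proof
    show "inj_on (\<lambda>i. cis (\<theta> i (\<gamma> t))) {1..n}" if "\<bar>t\<bar> < \<epsilon>" for t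
      using lab \<gamma>U[OF that] unfolding spectral_labelling_def bij_betw_def by blast
    show "E w t * (\<Sum>i\<in>{1..n}. complex_of_real (\<mu> i (\<gamma> t)) / (w - cis (\<theta> i (\<gamma> t)))) = 1"
      if "\<bar>t\<bar> < \<epsilon>" "1 \<le> cmod w" "w \<notin> (\<lambda>i. cis (\<theta> i (\<gamma> t))) ` {1..n}" for t w
      unfolding E_def
      using spectral_labelling_secular[OF n UV[OF \<gamma>U[OF that(1)]] _ that(2,3), of "\<lambda>i. \<mu> i (\<gamma> t)"]
        lab \<gamma>U[OF that(1)] by blast
    show "E (cis (\<theta> i (\<gamma> t))) t = 0" if "\<bar>t\<bar> < \<epsilon>" "i \<in> {1..n}" for t i
      unfolding E_def
      using spectral_labelling_root[OF n UV[OF \<gamma>U[OF that(1)]] _ that(2),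
          of "\<lambda>i. \<theta> i (\<gamma> t)" "\<lambda>i. \<mu> i (\<gamma> t)"] lab \<gamma>U[OF that(1)] by blast
    show "isCont (\<lambda>t. cis (\<theta> i (\<gamma> t))) 0" if i: "i \<in> {1..n}" for i
    proof -
      have "continuous_on {- \<epsilon><..<\<epsilon>} (\<lambda>t. \<theta> i (\<gamma> t))"
        by (rule continuous_on_compose2[OF cont[rule_format, OF i] c\<gamma>]) (auto intro!: \<gamma>U)
      then have "isCont (\<lambda>t. \<theta> i (\<gamma> t)) 0"
        using eps by (simp add: continuous_on_eq_continuous_at)
      then show ?thesis unfolding cis_conv_exp by (intro continuous_intros)
    qed
    show "E w differentiable (at 0)" if "1 \<le> cmod w" for w
      using dE[OF that] by (rule differentiableI_vector)
  qed (simp_all add: eps)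
  define z' where "z' = (\<lambda>i. vector_derivative (\<lambda>t. cis (\<theta> i (\<gamma> t))) (at 0))"
  have z': "((\<lambda>t. cis (\<theta> i (\<gamma> t))) has_vector_derivative z' i) (at 0)" if "i \<in> {1..n}" for i
    unfolding z'_def using differentiable_root[OF that] by (simp only: vector_derivative_works)
  \<comment> \<open>The locale works with complex masses; taking the real part recovers the
    derivative of the real-valued mass.\<close>
  define \<mu>' where "\<mu>' = (\<lambda>i. Re (vector_derivative (\<lambda>t. complex_of_real (\<mu> i (\<gamma> t))) (at 0)))"
  have \<mu>': "((\<lambda>t. \<mu> i (\<gamma> t)) has_vector_derivative \<mu>' i) (at 0)" if "i \<in> {1..n}" for i
    using bounded_linear.has_vector_derivative[OF bounded_linear_Re
        differentiable_weight[OF that, unfolded vector_derivative_works]]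
    by (simp add: \<mu>'_def)
  have \<mu>'c: "((\<lambda>t. complex_of_real (\<mu> i (\<gamma> t))) has_vector_derivative of_real (\<mu>' i)) (at 0)"
    if "i \<in> {1..n}" for i
    using bounded_linear.has_vector_derivative[OF bounded_linear_of_real \<mu>'[OF that]] .
  show ?thesis
  proof (intro exI[of _ z'] exI[of _ \<mu>'] conjI ballI allI impI)
    show "((\<lambda>t. \<mu> i (\<alpha>(j := \<alpha> j + of_real t * \<delta>))) has_real_derivative \<mu>' i) (at 0)"
      if "i \<in> {1..n}" for i
      using \<mu>'[OF that] unfolding has_real_derivative_iff_has_vector_derivative \<gamma>_def .
    fix w :: complex assume w: "1 < cmod w"
    show "(\<Sum>i\<in>{1..n}. of_real (\<mu>' i) / (w - cis (\<theta> i \<alpha>)) + of_real (\<mu> i \<alpha>) * z' i / (w - cis (\<theta> i \<alpha>))\<^sup>2)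
       = (schur_d \<alpha> w j 0 n * \<delta> + schur_dbar \<alpha> w j 0 n * cnj \<delta>)
          * (\<Sum>i\<in>{1..n}. of_real (\<mu> i \<alpha>) / (w - cis (\<theta> i \<alpha>)))\<^sup>2"
      using resolvent_derivative[OF z' \<mu>'c dE w] w by (simp add: \<gamma>0)
  qed
qed

text \<open>Bilinearity: the bracket of two sums of poles is expanded into products of poles in
  \<open>x\<close> and \<open>y\<close>, with the brackets of their coefficients in front. The
  a-families belong to simple poles, the b-families to double poles.\<close>

lemma bracket_of_linear_combinations:
  fixes au av bu bv :: "'k \<Rightarrow> 'i \<Rightarrow> complex" and R :: "'k \<Rightarrow> complex"
    and K :: "'k set"
  defines "br \<equiv> \<lambda>fu fv gu gv i l. \<Sum>j\<in>K. R j * (fu j i * gv j l - fv j i * gu j l :: complex)"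
  shows "(\<Sum>i\<in>J. (\<Sum>l\<in>J. br au av au av i l / y l + br au av bu bv i l / (y l)\<^sup>2) / x i
          + (\<Sum>l\<in>J. br bu bv au av i l / y l + br bu bv bu bv i l / (y l)\<^sup>2) / (x i)\<^sup>2)
    = (\<Sum>j\<in>K. R j *
        ((\<Sum>i\<in>J. au j i / x i + bu j i / (x i)\<^sup>2) * (\<Sum>l\<in>J. av j l / y l + bv j l / (y l)\<^sup>2)
         - (\<Sum>i\<in>J. av j i / x i + bv j i / (x i)\<^sup>2) * (\<Sum>l\<in>J. au j l / y l + bu j l / (y l)\<^sup>2)))"
proof -
  let ?T = "\<lambda>j i l. R j * ((au j i / x i + bu j i / (x i)\<^sup>2) * (av j l / y l + bv j l / (y l)\<^sup>2)
         - (av j i / x i + bv j i / (x i)\<^sup>2) * (au j l / y l + bu j l / (y l)\<^sup>2))"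
  have "(\<Sum>i\<in>J. (\<Sum>l\<in>J. br au av au av i l / y l + br au av bu bv i l / (y l)\<^sup>2) / x i
          + (\<Sum>l\<in>J. br bu bv au av i l / y l + br bu bv bu bv i l / (y l)\<^sup>2) / (x i)\<^sup>2)
     = (\<Sum>i\<in>J. \<Sum>l\<in>J. \<Sum>j\<in>K. ?T j i l)"
    unfolding br_def sum_divide_distrib sum.distrib[symmetric]
    by (intro sum.cong refl)
      (simp add: divide_inverse algebra_simps)
  also have "\<dots> = (\<Sum>i\<in>J. \<Sum>j\<in>K. \<Sum>l\<in>J. ?T j i l)"
    by (intro sum.cong refl sum.swap)
  also have "\<dots> = (\<Sum>j\<in>K. \<Sum>i\<in>J. \<Sum>l\<in>J. ?T j i l)"
    by (rule sum.swap)
  also have "\<dots> = (\<Sum>j\<in>K. R j *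
        ((\<Sum>i\<in>J. au j i / x i + bu j i / (x i)\<^sup>2) * (\<Sum>l\<in>J. av j l / y l + bv j l / (y l)\<^sup>2)
         - (\<Sum>i\<in>J. av j i / x i + bv j i / (x i)\<^sup>2) * (\<Sum>l\<in>J. au j l / y l + bu j l / (y l)\<^sup>2)))"
    by (intro sum.cong refl, simp only: sum_product)
      (simp only: sum_subtractf flip: sum_distrib_left)
  finally show ?thesis .
qed

text \<open>As s = 1 / (z - e) has derivative s^2 with respect to e, the left side is the
  transported Schur bracket; e s = z s - 1 then eliminates e.\<close>

lemma schur_bracket_in_resolvents:
  fixes z w e e' s s' :: complex
  assumes "(z - e) * s = 1" "(w - e') * s' = 1"
  shows "s\<^sup>2 * s'\<^sup>2 * ((z * e' - w * e) * (e' - e) / (z - w))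
       = (w * s' - z * s) * (s' - s - (z - w) * s * s') / (z - w)"
proof -
  have es: "e * s = z * s - 1" "e' * s' = w * s' - 1" using assms by (simp_all add: algebra_simps)
  have "s * s' * (z * e' - w * e) = z * s * (e' * s') - w * s' * (e * s)"
    by (simp add: algebra_simps)
  also have "\<dots> = w * s' - z * s" unfolding es by (simp add: algebra_simps)
  finally have 1: "s * s' * (z * e' - w * e) = w * s' - z * s" .
  have "s * s' * (e' - e) = s * (e' * s') - s' * (e * s)" by (simp add: algebra_simps)
  also have "\<dots> = s' - s - (z - w) * s * s'" unfolding es by (simp add: algebra_simps)
  finally have 2: "s * s' * (e' - e) = s' - s - (z - w) * s * s'" .
  show ?thesis unfolding 1[symmetric] 2[symmetric] by (simp add: power2_eq_square)
qed

text \<open>The source of the cotangents: factoring out the unit number at the mean angle leaves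
  cosine over i times sine of the half difference.\<close>

lemma cis_sum_div_diff:
  assumes "cis a \<noteq> cis b"
  shows "(cis b + cis a) / (cis b - cis a) = - \<i> * of_real (cot ((b - a) / 2))"
proof -
  define m h where "m = (a + b) / 2" and "h = (b - a) / 2"
  have b: "cis b = cis m * cis h" and a: "cis a = cis m * cis (- h)"
    by (simp_all add: cis_mult m_def h_def field_simps)
  have s: "cis h + cis (- h) = 2 * of_real (cos h)" "cis h - cis (- h) = 2 * \<i> * of_real (sin h)"
    by (simp_all add: complex_eq_iff)
  have "cis b - cis a = cis m * (cis h - cis (- h))" unfolding a b by (simp add: right_diff_distrib)
  then have "sin h \<noteq> 0" using assms s by auto
  have "(cis b + cis a) / (cis b - cis a) = (cis h + cis (- h)) / (cis h - cis (- h))"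
    unfolding a b distrib_left[symmetric] right_diff_distrib[symmetric] by simp
  also have "\<dots> = - \<i> * of_real (cos h / sin h)"
    unfolding s using \<open>sin h \<noteq> 0\<close> by (simp add: divide_simps)
  finally show ?thesis by (simp add: cot_def h_def)
qed

text \<open>Each \<open>{log \<mu> i, log \<mu> k}\<close> equals \<open>2 * cot ((\<theta> i - \<theta> k) / 2)\<close> up to a coboundary \<open>a k - a i\<close>,
  which the bracket of logarithms of ratios does not see.\<close>

lemma weight_bracket:
  fixes \<theta> \<mu> :: "nat \<Rightarrow> (nat \<Rightarrow> complex) \<Rightarrow> real"
  assumes n: "0 < n" and U: "openin (top_of_set (cmv_manifold n d)) U"
    and cont: "\<forall>i\<in>{1..n}. continuous_on U (\<theta> i)"
    and lab: "\<forall>\<gamma>\<in>U. spectral_labelling n \<gamma> (\<lambda>i. \<theta> i \<gamma>) (\<lambda>i. \<mu> i \<gamma>)"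
    and \<alpha>: "\<alpha> \<in> U"
  shows "\<exists>(mu :: nat \<Rightarrow> nat \<Rightarrow> real) (mv :: nat \<Rightarrow> nat \<Rightarrow> real) (a :: nat \<Rightarrow> complex).
    (\<forall>j<n - 1. \<forall>i\<in>{1..n}.
       ((\<lambda>t. \<mu> i (\<alpha>(j := \<alpha> j + of_real t))) has_real_derivative mu j i) (at 0)) \<and>
    (\<forall>j<n - 1. \<forall>i\<in>{1..n}.
       ((\<lambda>t. \<mu> i (\<alpha>(j := \<alpha> j + \<i> * of_real t))) has_real_derivative mv j i) (at 0)) \<and>
    (\<forall>i\<in>{1..n}. \<forall>k\<in>{1..n}. i \<noteq> k \<longrightarrow>
       of_real (\<Sum>j<n - 1. (rho \<alpha> j)\<^sup>2 * (mu j i * mv j k - mv j i * mu j k))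
         = of_real (\<mu> i \<alpha> * \<mu> k \<alpha>) * (of_real (2 * cot ((\<theta> i \<alpha> - \<theta> k \<alpha>) / 2)) + a k - a i))"
proof -
  let ?J = "{1..n}"
  define p where "p = (\<lambda>i. cis (\<theta> i \<alpha>))"
  define M where "M = (\<lambda>i. complex_of_real (\<mu> i \<alpha>))"
  define s where "s = (\<lambda>z. \<Sum>i\<in>?J. M i / (z - p i))"
  define P where "P = (\<lambda>w j. schur_d \<alpha> w j 0 n)"
  define Q where "Q = (\<lambda>w j. schur_dbar \<alpha> w j 0 n)"
  have \<alpha>v: "\<alpha> \<in> verblunsky n"
    using openin_imp_subset[OF U] \<alpha> by (auto simp: cmv_manifold_def)
  have lab\<alpha>: "spectral_labelling n \<alpha> (\<lambda>i. \<theta> i \<alpha>) (\<lambda>i. \<mu> i \<alpha>)" using lab \<alpha> by blast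
  have inj: "inj_on p ?J" using lab\<alpha> unfolding spectral_labelling_def bij_betw_def p_def by blast
  have unit: "cmod (p i) = 1" for i by (simp add: p_def)
  have "\<forall>j. \<exists>z' \<mu>'. j < n - 1 \<longrightarrow>
     (\<forall>i\<in>?J. ((\<lambda>t. \<mu> i (\<alpha>(j := \<alpha> j + of_real t * 1))) has_real_derivative \<mu>' i) (at 0)) \<and>
     (\<forall>w. 1 < cmod w \<longrightarrow>
       (\<Sum>i\<in>?J. of_real (\<mu>' i) / (w - p i) + M i * z' i / (w - p i)\<^sup>2)
       = (P w j * 1 + Q w j * cnj 1) * (s w)\<^sup>2)"
    using spectral_data_derivative[OF n U cont lab \<alpha>, of _ 1]
    unfolding p_def M_def P_def Q_def s_def by blast
  from this[unfolded choice_iff] obtain zu mu where u: "\<And>j. j < n - 1 \<Longrightarrow>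
     (\<forall>i\<in>?J. ((\<lambda>t. \<mu> i (\<alpha>(j := \<alpha> j + of_real t * 1))) has_real_derivative mu j i) (at 0)) \<and>
     (\<forall>w. 1 < cmod w \<longrightarrow>
       (\<Sum>i\<in>?J. of_real (mu j i) / (w - p i) + M i * zu j i / (w - p i)\<^sup>2)
       = (P w j * 1 + Q w j * cnj 1) * (s w)\<^sup>2)"
    by blast
  have "\<forall>j. \<exists>z' \<mu>'. j < n - 1 \<longrightarrow>
     (\<forall>i\<in>?J. ((\<lambda>t. \<mu> i (\<alpha>(j := \<alpha> j + of_real t * \<i>))) has_real_derivative \<mu>' i) (at 0)) \<and>
     (\<forall>w. 1 < cmod w \<longrightarrow>
       (\<Sum>i\<in>?J. of_real (\<mu>' i) / (w - p i) + M i * z' i / (w - p i)\<^sup>2)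
       = (P w j * \<i> + Q w j * cnj \<i>) * (s w)\<^sup>2)"
    using spectral_data_derivative[OF n U cont lab \<alpha>, of _ \<i>]
    unfolding p_def M_def P_def Q_def s_def by blast
  from this[unfolded choice_iff] obtain zv mv where v: "\<And>j. j < n - 1 \<Longrightarrow>
     (\<forall>i\<in>?J. ((\<lambda>t. \<mu> i (\<alpha>(j := \<alpha> j + of_real t * \<i>))) has_real_derivative mv j i) (at 0)) \<and>
     (\<forall>w. 1 < cmod w \<longrightarrow>
       (\<Sum>i\<in>?J. of_real (mv j i) / (w - p i) + M i * zv j i / (w - p i)\<^sup>2)
       = (P w j * \<i> + Q w j * cnj \<i>) * (s w)\<^sup>2)"
    by blast
  define R where "R = (\<lambda>j. 1 - \<alpha> j * cnj (\<alpha> j))"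
  have R: "R j = of_real ((rho \<alpha> j)\<^sup>2)" if "j < n - 1" for j
  proof -
    have "cmod (\<alpha> j) \<le> 1" using \<alpha>v that by (auto simp: verblunsky_def intro: less_imp_le)
    then show ?thesis
      by (simp add: R_def rho_def power_le_one complex_norm_square[symmetric])
  qed
  \<comment> \<open>The Schur identity sums over all \<open>n\<close> coefficients, the bracket over
    \<open>n - 1\<close> coordinates; the extra weight vanishes because the last coefficient has
    modulus one.\<close>
  have R_last: "R (n - 1) = 0"
  proof -
    have "cmod (\<alpha> (n - 1)) = 1" using \<alpha>v by (simp add: verblunsky_def)
    then show ?thesis by (simp add: R_def complex_norm_square[symmetric])
  qed
  define br where "br = (\<lambda>(fu :: nat \<Rightarrow> nat \<Rightarrow> complex) (fv :: nat \<Rightarrow> nat \<Rightarrow> complex)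
      (gu :: nat \<Rightarrow> nat \<Rightarrow> complex) (gv :: nat \<Rightarrow> nat \<Rightarrow> complex) i l.
      \<Sum>j<n - 1. R j * (fu j i * gv j l - fv j i * gu j l))"
  define au av bu bv where "au = (\<lambda>j i. complex_of_real (mu j i))"
    and "av = (\<lambda>j i. complex_of_real (mv j i))"
    and "bu = (\<lambda>j i. M i * zu j i)" and "bv = (\<lambda>j i. M i * zv j i)"
  have bracket: "(\<Sum>i\<in>?J. (\<Sum>l\<in>?J. br au av au av i l / (w - p l) + br au av bu bv i l / (w - p l)\<^sup>2) / (z - p i)
          + (\<Sum>l\<in>?J. br bu bv au av i l / (w - p l) + br bu bv bu bv i l / (w - p l)\<^sup>2) / (z - p i)\<^sup>2)
       = (- 2 * \<i>) * ((w * s w - z * s z) * (s w - s z - (z - w) * s z * s w) / (z - w))"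
    if z: "1 < cmod z" and w: "1 < cmod w" and zw: "z \<noteq> w" for z w
  proof -
    define e where "e = schur_fn \<alpha> z 0 n"
    define e' where "e' = schur_fn \<alpha> w 0 n"
    have nev: "x \<notin> (\<lambda>i. cis (\<theta> i \<alpha>)) ` ?J" if "1 < cmod x" for x using that by auto
    have es: "(z - e) * s z = 1" "(w - e') * s w = 1"
      using spectral_labelling_secular[OF n \<alpha>v lab\<alpha> _ nev] z w
      unfolding e_def e'_def s_def M_def p_def by auto
    have su: "(\<Sum>i\<in>?J. au j i / (x - p i) + bu j i / (x - p i)\<^sup>2) = (P x j + Q x j) * (s x)\<^sup>2"
      if "j < n - 1" "1 < cmod x" for j x
      using u[OF that(1)] that(2) by (simp add: au_def bu_def)
    have sv: "(\<Sum>i\<in>?J. av j i / (x - p i) + bv j i / (x - p i)\<^sup>2) = \<i> * (P x j - Q x j) * (s x)\<^sup>2"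
      if "j < n - 1" "1 < cmod x" for j x
      using v[OF that(1)] that(2) by (simp add: av_def bv_def algebra_simps)
    \<comment> \<open>The passage from u, v to Wirtinger derivatives, producing the factor - 2
      i.\<close>
    have wirtinger: "r * ((P1 + Q1) * x * (\<i> * (P2 - Q2) * y) - \<i> * (P1 - Q1) * x * ((P2 + Q2) * y))
        = (- 2 * \<i>) * (x * y) * (r * (P1 * Q2 - Q1 * P2))" for r P1 P2 Q1 Q2 x y :: complex
      by (simp add: algebra_simps)
    have "(\<Sum>i\<in>?J. (\<Sum>l\<in>?J. br au av au av i l / (w - p l) + br au av bu bv i l / (w - p l)\<^sup>2) / (z - p i)
          + (\<Sum>l\<in>?J. br bu bv au av i l / (w - p l) + br bu bv bu bv i l / (w - p l)\<^sup>2) / (z - p i)\<^sup>2)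
       = (\<Sum>j<n - 1. R j *
        ((\<Sum>i\<in>?J. au j i / (z - p i) + bu j i / (z - p i)\<^sup>2) * (\<Sum>l\<in>?J. av j l / (w - p l) + bv j l / (w - p l)\<^sup>2)
         - (\<Sum>i\<in>?J. av j i / (z - p i) + bv j i / (z - p i)\<^sup>2) * (\<Sum>l\<in>?J. au j l / (w - p l) + bu j l / (w - p l)\<^sup>2)))"
      unfolding br_def by (rule bracket_of_linear_combinations)
    also have "\<dots> = (\<Sum>j<n - 1. (- 2 * \<i>) * ((s z)\<^sup>2 * (s w)\<^sup>2) * (R j * (P z j * Q w j - Q z j * P w j)))"
    proof (rule sum.cong[OF refl])
      fix j assume "j \<in> {..<n - 1}"
      then have j: "j < n - 1" by simp
      show "R j *
        ((\<Sum>i\<in>?J. au j i / (z - p i) + bu j i / (z - p i)\<^sup>2) * (\<Sum>l\<in>?J. av j l / (w - p l) + bv j l / (w - p l)\<^sup>2)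
         - (\<Sum>i\<in>?J. av j i / (z - p i) + bv j i / (z - p i)\<^sup>2) * (\<Sum>l\<in>?J. au j l / (w - p l) + bu j l / (w - p l)\<^sup>2))
        = (- 2 * \<i>) * ((s z)\<^sup>2 * (s w)\<^sup>2) * (R j * (P z j * Q w j - Q z j * P w j))"
        unfolding su[OF j z] su[OF j w] sv[OF j z] sv[OF j w] by (rule wirtinger)
    qed
    also have "\<dots> = (- 2 * \<i>) * ((s z)\<^sup>2 * (s w)\<^sup>2) * (\<Sum>j<n - 1. R j * (P z j * Q w j - Q z j * P w j))"
      by (simp only: sum_distrib_left)
    also have "(\<Sum>j<n - 1. R j * (P z j * Q w j - Q z j * P w j))
        = (\<Sum>j=0..<0+n. R j * (P z j * Q w j - Q z j * P w j))"
    proof -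
      have "{0..<0+n} = insert (n - 1) {..<n - 1}" using n by auto
      then show ?thesis using R_last by simp
    qed
    also have "\<dots> = (z * e' - w * e) * (e' - e) / (z - w)"
      unfolding R_def P_def Q_def e_def e'_def
      by (rule schur_fn_bracket[OF verblunsky_admissible[OF n \<alpha>v]]) (use z w zw in auto)
    also have "(- 2 * \<i>) * ((s z)\<^sup>2 * (s w)\<^sup>2) * \<dots>
        = (- 2 * \<i>) * ((w * s w - z * s z) * (s w - s z - (z - w) * s z * s w) / (z - w))"
      using schur_bracket_in_resolvents[OF es] by (simp only: mult.assoc)
    finally show ?thesis .
  qed
  \<comment> \<open>The potential of the coboundary: - 2 i (- A k + A i) = a k - a i for a = 2 i A,
    the witness below.\<close>
  define A where "A = (\<lambda>i. \<Sum>l\<in>?J - {i}. M l * (p i + p l) / (p i - p l))"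
  show ?thesis
  proof (rule exI[of _ mu], rule exI[of _ mv], rule exI[of _ "\<lambda>i. 2 * \<i> * A i"],
      intro conjI allI ballI impI)
    show "((\<lambda>t. \<mu> i (\<alpha>(j := \<alpha> j + of_real t))) has_real_derivative mu j i) (at 0)"
      if "j < n - 1" "i \<in> ?J" for j i
      using u[OF that(1)] that(2) by simp
    show "((\<lambda>t. \<mu> i (\<alpha>(j := \<alpha> j + \<i> * of_real t))) has_real_derivative mv j i) (at 0)"
      if "j < n - 1" "i \<in> ?J" for j i
      using v[OF that(1)] that(2) by (simp add: mult.commute)
    fix i k assume i: "i \<in> ?J" and k: "k \<in> ?J" and ik: "i \<noteq> k"
    have br: "br au av au av i k = (- 2 * \<i>) * (M i * M k * ((p k + p i) / (p k - p i) - A k + A i))"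
      unfolding A_def
    proof (rule residue_of_resolvent_bracket[where J = ?J and p = p and \<mu> = M and c = "- 2 * \<i>"
          and MM = "br au av au av" and MZ = "br au av bu bv" and ZM = "br bu bv au av"
          and ZZ = "br bu bv bu bv" and j = i and k = k])
      show "inj_on p ?J" "i \<in> ?J" "k \<in> ?J" "i \<noteq> k" "\<And>i. cmod (p i) = 1" by fact+
    qed (simp, (rule bracket[unfolded s_def]; assumption))
    have ratio: "(p k + p i) / (p k - p i) = \<i> * of_real (cot ((\<theta> i \<alpha> - \<theta> k \<alpha>) / 2))"
    proof -
      have "p i \<noteq> p k" using inj_onD[OF inj _ i k] ik by blast
      then have "(p i + p k) / (p i - p k) = - \<i> * of_real (cot ((\<theta> i \<alpha> - \<theta> k \<alpha>) / 2))"
        unfolding p_def by (intro cis_sum_div_diff) auto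
      moreover have "(p k + p i) / (p k - p i) = - ((p i + p k) / (p i - p k))"
        by (metis add.commute divide_minus_right minus_diff_eq)
      ultimately show ?thesis by simp
    qed
    have brR: "br au av au av i k
        = of_real (\<Sum>j<n - 1. (rho \<alpha> j)\<^sup>2 * (mu j i * mv j k - mv j i * mu j k))"
      unfolding br_def by (simp add: R au_def av_def)
    have "(- 2 * \<i>) * (x * (\<i> * c - y + y')) = x * (2 * c + 2 * \<i> * y - 2 * \<i> * y')"
      for x c y y' :: complex
      by (simp add: algebra_simps)
    then have "of_real (\<Sum>j<n - 1. (rho \<alpha> j)\<^sup>2 * (mu j i * mv j k - mv j i * mu j k))
        = M i * M k * (2 * of_real (cot ((\<theta> i \<alpha> - \<theta> k \<alpha>) / 2)) + 2 * \<i> * A k - 2 * \<i> * A i)"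
      unfolding brR[symmetric] br ratio .
    then show "of_real (\<Sum>j<n - 1. (rho \<alpha> j)\<^sup>2 * (mu j i * mv j k - mv j i * mu j k))
        = of_real (\<mu> i \<alpha> * \<mu> k \<alpha>)
            * (of_real (2 * cot ((\<theta> i \<alpha> - \<theta> k \<alpha>) / 2)) + 2 * \<i> * A k - 2 * \<i> * A i)"
      by (simp only: M_def of_real_mult of_real_numeral)
  qed
qed

theorem proposition8p4:
  fixes n :: nat and d :: complex
    and U :: "(nat \<Rightarrow> complex) set"
    and \<theta> \<mu> :: "nat \<Rightarrow> (nat \<Rightarrow> complex) \<Rightarrow> real"
    and \<alpha> :: "nat \<Rightarrow> complex"
  assumes "n \<ge> 3"
    and "openin (top_of_set (cmv_manifold n d)) U"
    and "\<forall>j \<in> {1..n}. continuous_on U (\<theta> j)"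
    and "\<forall>\<gamma> \<in> U. spectral_labelling n \<gamma> (\<lambda>j. \<theta> j \<gamma>) (\<lambda>j. \<mu> j \<gamma>)"
    and "\<alpha> \<in> U"
  shows "AL_bracket n (\<lambda>\<gamma>. ln (\<mu> 2 \<gamma> / \<mu> 1 \<gamma>)) (\<lambda>\<gamma>. ln (\<mu> 3 \<gamma> / \<mu> 1 \<gamma>)) \<alpha> =
     2 * cot ((\<theta> 1 \<alpha> - \<theta> 2 \<alpha>) / 2)
       + 2 * cot ((\<theta> 2 \<alpha> - \<theta> 3 \<alpha>) / 2)
       + 2 * cot ((\<theta> 3 \<alpha> - \<theta> 1 \<alpha>) / 2)"
proof -
  have n: "0 < n" using assms(1) by simp
  obtain mu mv a where
    du: "\<forall>j<n - 1. \<forall>i\<in>{1..n}.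
       ((\<lambda>t. \<mu> i (\<alpha>(j := \<alpha> j + of_real t))) has_real_derivative mu j i) (at 0)" and
    dv: "\<forall>j<n - 1. \<forall>i\<in>{1..n}.
       ((\<lambda>t. \<mu> i (\<alpha>(j := \<alpha> j + \<i> * of_real t))) has_real_derivative mv j i) (at 0)" and
    br: "\<forall>i\<in>{1..n}. \<forall>k\<in>{1..n}. i \<noteq> k \<longrightarrow>
       complex_of_real (\<Sum>j<n - 1. (rho \<alpha> j)\<^sup>2 * (mu j i * mv j k - mv j i * mu j k))
         = of_real (\<mu> i \<alpha> * \<mu> k \<alpha>) * (of_real (2 * cot ((\<theta> i \<alpha> - \<theta> k \<alpha>) / 2)) + a k - a i)"
    using weight_bracket[OF n assms(2-5)] by blast
  have pos: "0 < \<mu> i \<alpha>" if "i \<in> {1..n}" for i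
    using assms(4,5) that unfolding spectral_labelling_def by blast
  have J: "1 \<in> {1..n}" "2 \<in> {1..n}" "3 \<in> {1..n}" using assms(1) by auto
  have ne: "(2::nat) \<noteq> 3" "(2::nat) \<noteq> 1" "(1::nat) \<noteq> 3" by auto
  have log_deriv: "((\<lambda>t. ln (f t / g t)) has_real_derivative f' / f 0 - g' / g 0) (at 0)"
    if "(f has_real_derivative f') (at 0)" "(g has_real_derivative g') (at 0)" "0 < f 0" "0 < g 0"
    for f g :: "real \<Rightarrow> real" and f' g'
    using that by (auto intro!: derivative_eq_intros simp: field_simps)
  have pu: "partial_u j (\<lambda>\<gamma>. ln (\<mu> i \<gamma> / \<mu> 1 \<gamma>)) \<alpha> = mu j i / \<mu> i \<alpha> - mu j 1 / \<mu> 1 \<alpha>"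
    if "j < n - 1" "i \<in> {1..n}" for i j
    unfolding partial_u_def
    using log_deriv[OF du[rule_format, OF that] du[rule_format, OF that(1) J(1)]] pos[OF that(2)] pos[OF J(1)]
    by (intro DERIV_imp_deriv) simp
  have pv: "partial_v j (\<lambda>\<gamma>. ln (\<mu> i \<gamma> / \<mu> 1 \<gamma>)) \<alpha> = mv j i / \<mu> i \<alpha> - mv j 1 / \<mu> 1 \<alpha>"
    if "j < n - 1" "i \<in> {1..n}" for i j
    unfolding partial_v_def
    using log_deriv[OF dv[rule_format, OF that] dv[rule_format, OF that(1) J(1)]] pos[OF that(2)] pos[OF J(1)]
    by (intro DERIV_imp_deriv) simp
  define B where "B = (\<lambda>i k. \<Sum>j<n - 1. (rho \<alpha> j)\<^sup>2 * (mu j i * mv j k - mv j i * mu j k))"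
  have B: "complex_of_real (B i k / (\<mu> i \<alpha> * \<mu> k \<alpha>))
      = of_real (2 * cot ((\<theta> i \<alpha> - \<theta> k \<alpha>) / 2)) + a k - a i"
    if "i \<in> {1..n}" "k \<in> {1..n}" "i \<noteq> k" for i k
    using br[rule_format, OF that] pos[OF that(1)] pos[OF that(2)] unfolding B_def of_real_divide by simp
  have set_eq: "{0..n - 2} = {..<n - 1}" using assms(1) by auto
  have "AL_bracket n (\<lambda>\<gamma>. ln (\<mu> 2 \<gamma> / \<mu> 1 \<gamma>)) (\<lambda>\<gamma>. ln (\<mu> 3 \<gamma> / \<mu> 1 \<gamma>)) \<alpha>
     = (\<Sum>j<n - 1. (rho \<alpha> j)\<^sup>2 *
          ((mu j 2 / \<mu> 2 \<alpha> - mu j 1 / \<mu> 1 \<alpha>) * (mv j 3 / \<mu> 3 \<alpha> - mv j 1 / \<mu> 1 \<alpha>)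
           - (mv j 2 / \<mu> 2 \<alpha> - mv j 1 / \<mu> 1 \<alpha>) * (mu j 3 / \<mu> 3 \<alpha> - mu j 1 / \<mu> 1 \<alpha>)))"
    unfolding AL_bracket_def set_eq
    by (intro sum.cong refl)
      (simp only: lessThan_iff pu[OF _ J(2)] pu[OF _ J(3)] pv[OF _ J(2)] pv[OF _ J(3)])
  \<comment> \<open>Bilinear expansion of the bracket of log \<mu> 2 - log \<mu> 1 with log \<mu> 3
    - log \<mu> 1; the term pairing log \<mu> 1 with itself vanishes by antisymmetry.\<close>
  also have "\<dots> = B 2 3 / (\<mu> 2 \<alpha> * \<mu> 3 \<alpha>) - B 2 1 / (\<mu> 2 \<alpha> * \<mu> 1 \<alpha>) - B 1 3 / (\<mu> 1 \<alpha> * \<mu> 3 \<alpha>)"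
    unfolding B_def sum_divide_distrib sum_subtractf[symmetric]
    by (rule sum.cong) (simp_all add: divide_inverse algebra_simps)
  finally have AL: "AL_bracket n (\<lambda>\<gamma>. ln (\<mu> 2 \<gamma> / \<mu> 1 \<gamma>)) (\<lambda>\<gamma>. ln (\<mu> 3 \<gamma> / \<mu> 1 \<gamma>)) \<alpha>
     = B 2 3 / (\<mu> 2 \<alpha> * \<mu> 3 \<alpha>) - B 2 1 / (\<mu> 2 \<alpha> * \<mu> 1 \<alpha>) - B 1 3 / (\<mu> 1 \<alpha> * \<mu> 3 \<alpha>)" .
  have cot_swap: "cot ((x - y) / 2) = - cot ((y - x) / 2)" for x y :: real
    using cot_minus[of "(y - x) / 2"] by (simp only: minus_divide_left minus_diff_eq)
  \<comment> \<open>The comparison is made over the complex numbers because \<open>a\<close> is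
    complex-valued. Its contributions cancel: (a 3 - a 2) - (a 1 - a 2) - (a 3 - a 1) = 0.\<close>
  have "complex_of_real (AL_bracket n (\<lambda>\<gamma>. ln (\<mu> 2 \<gamma> / \<mu> 1 \<gamma>)) (\<lambda>\<gamma>. ln (\<mu> 3 \<gamma> / \<mu> 1 \<gamma>)) \<alpha>)
     = of_real (2 * cot ((\<theta> 2 \<alpha> - \<theta> 3 \<alpha>) / 2) - 2 * cot ((\<theta> 2 \<alpha> - \<theta> 1 \<alpha>) / 2)
                - 2 * cot ((\<theta> 1 \<alpha> - \<theta> 3 \<alpha>) / 2))"
    unfolding AL of_real_diff B[OF J(2) J(3) ne(1)] B[OF J(2) J(1) ne(2)] B[OF J(1) J(3) ne(3)]
    by simp
  then have "AL_bracket n (\<lambda>\<gamma>. ln (\<mu> 2 \<gamma> / \<mu> 1 \<gamma>)) (\<lambda>\<gamma>. ln (\<mu> 3 \<gamma> / \<mu> 1 \<gamma>)) \<alpha>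
     = 2 * cot ((\<theta> 2 \<alpha> - \<theta> 3 \<alpha>) / 2) - 2 * cot ((\<theta> 2 \<alpha> - \<theta> 1 \<alpha>) / 2)
                - 2 * cot ((\<theta> 1 \<alpha> - \<theta> 3 \<alpha>) / 2)"
    by (simp only: of_real_eq_iff)
  then show ?thesis
    using cot_swap[of "\<theta> 2 \<alpha>" "\<theta> 1 \<alpha>"] cot_swap[of "\<theta> 1 \<alpha>" "\<theta> 3 \<alpha>"] by simp
qed

end
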